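(* Consider broadcasting on the 2D grid: nodes are indexed by $(t,i)$ with $t\ge 0$, $0\le i\le t$, with bit $\eta_t(i)$. The origin holds a bit $\eta_0(0)$. For $t\ge1$, the boundary nodes set $\eta_t(0)=\mathrm{BSC}_p(\eta_{t-1}(0))$ and $\eta_t(t)=\mathrm{BSC}_p(\eta_{t-1}(t-1))$, and each interior node $0<i<t$ sets $\eta_t(i)=f\big(\mathrm{BSC}_p(\eta_{t-1}(i-1)),\mathrm{BSC}_p(\eta_{t-1}(i))\big)$ for a fixed function $f:\{0,1\}^2\to\{0,1\}$, where all channel uses (one per edge) are independent. Let $\eta_t^+$ and $\eta_t^-$ denote the configuration at level $t$ when the origin bit is $1$ and $0$, respectively. Then for any function $f:\{0,1\}^2\to\{0,1\}$ there exists $\epsilon>0$ such that for every $p\in(0,\epsilon)$, $\lim_{t\to\infty} d_{\mathrm{TV}}(P_{\eta_t^+},P_{\eta_t^-})=0$.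
   Context: $\mathrm{BSC}_p$ flips its input bit with probability $p$ and leaves it unchanged otherwise. $P_{\eta}$ denotes the law of the random vector $\eta$ and $d_{\mathrm{TV}}$ the total variation distance. *)

theory Defs
  imports "HOL-Probability.Probability"
begin

type_synonym node = "nat \<times> nat"

text \<open>The edges among levels \<open>0, \<dots>, t\<close>: node \<open>(s, j)\<close> feeds \<open>(s + 1, j)\<close> and \<open>(s + 1, j + 1)\<close>.\<close>

definition grid_edges :: "nat \<Rightarrow> (node \<times> node) set" where
  "grid_edges t = {((s, j), (Suc s, k)) | s j k. s < t \<and> j \<le> s \<and> (k = j \<or> k = Suc j)}"

text \<open>Needed for \<^const>\<open>Pi_pmf\<close> over \<open>grid_edges t\<close> to be meaningful.\<close>

lemma finite_grid_edges [simp]: "finite (grid_edges t)"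
proof (rule finite_subset)
  show "grid_edges t \<subseteq> ({..t} \<times> {..t}) \<times> ({..t} \<times> {..t})"
    by (auto simp: grid_edges_def)
qed simp

text \<open>With \<open>z\<close> distributed as \<open>bernoulli_pmf p\<close>, this is the output of the channel
  \<open>BSC\<^sub>p\<close> on input \<open>x\<close>: the bit is flipped exactly when \<open>z\<close> holds.\<close>

definition bsc :: "bool \<Rightarrow> bool \<Rightarrow> bool" where
  "bsc z x = (if z then \<not> x else x)"

text \<open>Bits are booleans. The configuration at level \<open>t\<close> is a function of the position \<open>i \<le> t\<close>,
  set to \<^const>\<open>False\<close> at all \<open>i > t\<close> so that it carries exactly \<open>t + 1\<close> bits.\<close>

fun eta :: "(bool \<Rightarrow> bool \<Rightarrow> bool) \<Rightarrow> (node \<times> node \<Rightarrow> bool) \<Rightarrow> bool \<Rightarrow> nat \<Rightarrow> nat \<Rightarrow> bool" where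
  "eta f z b 0 i = (if i = 0 then b else False)"
| "eta f z b (Suc s) i =
    (if i = 0 then bsc (z ((s, 0), (Suc s, 0))) (eta f z b s 0)
     else if i < Suc s then
       f (bsc (z ((s, i - 1), (Suc s, i))) (eta f z b s (i - 1)))
         (bsc (z ((s, i), (Suc s, i))) (eta f z b s i))
     else if i = Suc s then bsc (z ((s, s), (Suc s, Suc s))) (eta f z b s s)
     else False)"

definition edge_noise :: "real \<Rightarrow> nat \<Rightarrow> (node \<times> node \<Rightarrow> bool) pmf" where
  "edge_noise p t = Pi_pmf (grid_edges t) False (\<lambda>_. bernoulli_pmf p)"

definition eta_law :: "(bool \<Rightarrow> bool \<Rightarrow> bool) \<Rightarrow> real \<Rightarrow> bool \<Rightarrow> nat \<Rightarrow> (nat \<Rightarrow> bool) pmf" where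
  "eta_law f p b t = map_pmf (\<lambda>z. eta f z b t) (edge_noise p t)"

definition tv_dist :: "'a pmf \<Rightarrow> 'a pmf \<Rightarrow> real" where
  "tv_dist P Q = (SUP A. \<bar>measure_pmf.prob P A - measure_pmf.prob Q A\<bar>)"

end

theory Submission
  imports Defs
begin

text \<open>
  Replace each \<open>BSC\<^sub>p\<close> by a channel that keeps its input with probability \<open>1 - 2p\<close> and otherwise emits a
  fresh fair bit. Starting from an undetermined origin bit, every node is then either determined by the
  fresh bits or undetermined, and the total variation distance is at most the probability that level
  \<open>t\<close> contains an undetermined node. The sixteen gates fall into three groups.

  For XOR and XNOR, row \<open>2\<^sup>k\<close> of Pascal's triangle modulo 2 vanishes in its interior, so flipping the
  origin amounts to flipping the noise on the edges into \<open>(2\<^sup>k, 0)\<close> and \<open>(2\<^sup>k, 2\<^sup>k)\<close>, for every \<open>k\<close>.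
  Averaging over these many independent pairs destroys the information.

  For AND and OR, explore the ancestors of a set of nodes level by level. Each level costs
  a factor \<open>1 - p\<close>, since no explored edge may carry the fresh dominant bit.

  For the other gates a weighted count of patterns containing undetermined nodes contracts in
  expectation away from the boundary, and every fixed column along the two boundaries becomes determined.
  For NAND the contraction rate is only of order \<open>1 - p\<^sup>2\<close>: in the limit of small \<open>p\<close> the boundaries of
  undetermined regions perform driftless random walks.
\<close>

section \<open>Rows as a Markov chain with independent sites\<close>

lemma expectation_bind_pmf_finite:
  fixes h :: "'b \<Rightarrow> real"
  assumes "finite (set_pmf M)" "\<And>x. finite (set_pmf (N x))"
  shows "measure_pmf.expectation (bind_pmf M N) h
       = measure_pmf.expectation M (\<lambda>x. measure_pmf.expectation (N x) h)"
proof -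
  have "measure_pmf.expectation (bind_pmf M N) h
      = (\<Sum>a\<in>set_pmf M. pmf M a *\<^sub>R measure_pmf.expectation (N a) h)"
    using assms by (intro pmf_expectation_bind) auto
  also have "\<dots> = measure_pmf.expectation M (\<lambda>x. measure_pmf.expectation (N x) h)"
    using assms by (intro integral_measure_pmf[symmetric]) auto
  finally show ?thesis .
qed

lemma finite_set_Pi_pmf:
  fixes P :: "'a \<Rightarrow> 'b::finite pmf"
  assumes "finite A"
  shows "finite (set_pmf (Pi_pmf A d P))"
  using assms by (simp add: set_Pi_pmf finite_PiE_dflt)

text \<open>Independent sitewise couplings combine into a coupling of the product laws. The defaults
  must be related too, since the conclusion ranges over all \<open>i\<close>, also outside
  \<open>A\<close>.\<close>

lemma rel_pmf_Pi_pmf: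
  assumes "finite A" "R d d'" "\<And>i. i \<in> A \<Longrightarrow> rel_pmf R (P i) (Q i)"
  shows "rel_pmf (\<lambda>f g. \<forall>i. R (f i) (g i)) (Pi_pmf A d P) (Pi_pmf A d' Q)"
  using assms(1,3)
proof (induction A rule: finite_induct)
  case empty
  then show ?case using assms(2) by simp
next
  case (insert x A)
  have "rel_pmf (rel_prod R (\<lambda>f g. \<forall>i. R (f i) (g i)))
          (pair_pmf (P x) (Pi_pmf A d P)) (pair_pmf (Q x) (Pi_pmf A d' Q))"
    using insert by (simp add: rel_pmf_rel_prod)
  then show ?case
    unfolding Pi_pmf_insert[OF insert.hyps] pmf.rel_map
    by (rule pmf.rel_mono_strong) auto
qed

text \<open>Functions of disjoint blocks of independent coordinates are independent. This turns
  noise on edges into independent noise at the sites that these edges enter.\<close>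

lemma map_Pi_pmf_blocks:
  assumes "finite I" "\<And>i. i \<in> I \<Longrightarrow> finite (S i)" "disjoint_family_on S I"
    and "\<And>i z z'. i \<in> I \<Longrightarrow> (\<And>e. e \<in> S i \<Longrightarrow> z e = z' e) \<Longrightarrow> h i z = h i z'"
  shows "map_pmf (\<lambda>z i. if i \<in> I then h i z else d) (Pi_pmf (\<Union>i\<in>I. S i) d' P)
       = Pi_pmf I d (\<lambda>i. map_pmf (h i) (Pi_pmf (S i) d' P))"
  using assms
proof (induction I rule: finite_induct)
  case empty
  show ?case by simp
next
  case (insert j I)
  let ?U = "\<Union>i\<in>I. S i" and ?r = "\<lambda>z i. if i \<in> I then h i z else d"
  have fin: "finite (S j)" "finite ?U" using insert.prems(1) insert.hyps(1) by auto
  have disj: "S j \<inter> ?U = {}"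
    using insert.prems(2) insert.hyps(2) by (fastforce simp: disjoint_family_on_def)
  have IH: "map_pmf ?r (Pi_pmf ?U d' P) = Pi_pmf I d (\<lambda>i. map_pmf (h i) (Pi_pmf (S i) d' P))"
  proof (rule insert.IH)
    show "disjoint_family_on S I"
      using insert.prems(2) by (auto simp: disjoint_family_on_def)
    show "h i z = h i z'" if "i \<in> I" "\<And>e. e \<in> S i \<Longrightarrow> z e = z' e" for i z z'
      using that by (intro insert.prems(3)) auto
  qed (use insert.prems(1) in auto)
  have *: "(\<lambda>i. if i \<in> insert j I then h i (\<lambda>x. if x \<in> S j then f x else g x) else d)
      = (?r g)(j := h j f)" for f g
  proof
    fix i
    have "h j (\<lambda>x. if x \<in> S j then f x else g x) = h j f"
      by (intro insert.prems(3)) auto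
    moreover have "h i (\<lambda>x. if x \<in> S j then f x else g x) = h i g" if "i \<in> I"
      using that disj by (intro insert.prems(3)) auto
    ultimately show "(if i \<in> insert j I then h i (\<lambda>x. if x \<in> S j then f x else g x) else d)
      = ((?r g)(j := h j f)) i"
      by auto
  qed
  have "map_pmf (\<lambda>z i. if i \<in> insert j I then h i z else d) (Pi_pmf (S j \<union> ?U) d' P)
      = map_pmf (\<lambda>(f, g). (?r g)(j := h j f)) (pair_pmf (Pi_pmf (S j) d' P) (Pi_pmf ?U d' P))"
    by (simp add: Pi_pmf_union[OF fin disj] map_pmf_comp case_prod_unfold *[simplified])
  also have "\<dots> = map_pmf (\<lambda>(y, f). f(j := y))
      (pair_pmf (map_pmf (h j) (Pi_pmf (S j) d' P)) (map_pmf ?r (Pi_pmf ?U d' P)))"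
    by (simp add: pair_map_pmf1 pair_map_pmf2 map_pmf_comp case_prod_unfold)
  also have "\<dots> = Pi_pmf (insert j I) d (\<lambda>i. map_pmf (h i) (Pi_pmf (S i) d' P))"
    unfolding IH using insert.hyps by (simp add: Pi_pmf_insert)
  finally show ?case by simp
qed

text \<open>Here \<open>i\<close> is a position in row \<open>Suc t\<close>; the result lists
  positions in row \<open>t\<close>.\<close>

definition parents :: "nat \<Rightarrow> nat \<Rightarrow> nat set" where
  "parents t i = (if i = 0 then {0} else if i = Suc t then {t} else {i - 1, i})"

definition bit_node :: "(bool \<Rightarrow> bool \<Rightarrow> bool) \<Rightarrow> real \<Rightarrow> bool \<Rightarrow> bool \<Rightarrow> bool pmf" where
  "bit_node f p a b = map_pmf (\<lambda>(z, z'). f (bsc z a) (bsc z' b))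
     (pair_pmf (bernoulli_pmf p) (bernoulli_pmf p))"

definition bit_row :: "(bool \<Rightarrow> bool \<Rightarrow> bool) \<Rightarrow> real \<Rightarrow> nat \<Rightarrow> (nat \<Rightarrow> bool) \<Rightarrow> (nat \<Rightarrow> bool) pmf" where
  "bit_row f p t x = Pi_pmf {..Suc t} False (\<lambda>i.
     if i = 0 then map_pmf (\<lambda>z. bsc z (x 0)) (bernoulli_pmf p)
     else if i = Suc t then map_pmf (\<lambda>z. bsc z (x t)) (bernoulli_pmf p)
     else bit_node f p (x (i - 1)) (x i))"

lemma eta_cong:
  "(\<And>e. e \<in> grid_edges t \<Longrightarrow> z e = z' e) \<Longrightarrow> eta f z b t = eta f z' b t"
proof (induction t)
  case (Suc t)
  have "eta f z b t = eta f z' b t"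
    using Suc.prems by (intro Suc.IH) (auto simp: grid_edges_def)
  moreover have "z ((t, j), (Suc t, k)) = z' ((t, j), (Suc t, k))" if "j \<le> t" "k = j \<or> k = Suc j" for j k
    using that by (intro Suc.prems) (auto simp: grid_edges_def)
  ultimately show ?case by (auto simp: fun_eq_iff)
qed (simp add: fun_eq_iff)

lemma grid_edges_Suc:
  "grid_edges (Suc t) = grid_edges t \<union> (\<Union>i\<le>Suc t. (\<lambda>j. ((t, j), (Suc t, i))) ` parents t i)"
  (is "_ = _ \<union> ?N")
proof -
  have mem: "k \<le> Suc t \<and> j \<in> parents t k \<longleftrightarrow> j \<le> t \<and> (k = j \<or> k = Suc j)" for j k
    unfolding parents_def by (cases k) auto
  have "?N = {((t, j), (Suc t, k)) | j k. k \<le> Suc t \<and> j \<in> parents t k}"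
    by blast
  then have "?N = {((t, j), (Suc t, k)) | j k. j \<le> t \<and> (k = j \<or> k = Suc j)}"
    unfolding mem .
  moreover have "grid_edges (Suc t)
      = grid_edges t \<union> {((t, j), (Suc t, k)) | j k. j \<le> t \<and> (k = j \<or> k = Suc j)}"
    unfolding grid_edges_def less_Suc_eq by blast
  ultimately show ?thesis by simp
qed

text \<open>The edges into row \<open>Suc t\<close> are fresh, and edges into different sites of
  that row form disjoint blocks. Given row \<open>t\<close>, the sites of the next row are therefore
  independent.\<close>

lemma eta_law_Suc: "eta_law f p b (Suc t) = bind_pmf (eta_law f p b t) (bit_row f p t)"
proof -
  let ?S = "\<lambda>i. (\<lambda>j. ((t, j), (Suc t, i))) ` parents t i"
  let ?N = "\<Union>i\<in>{..Suc t}. ?S i"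
  let ?B = "\<lambda>_::node \<times> node. bernoulli_pmf p"
  define h where "h x i z =
    (if i = 0 then bsc (z ((t, 0), (Suc t, 0))) (x 0)
     else if i = Suc t then bsc (z ((t, t), (Suc t, Suc t))) (x t)
     else f (bsc (z ((t, i - 1), (Suc t, i))) (x (i - 1))) (bsc (z ((t, i), (Suc t, i))) (x i)))"
    for x :: "nat \<Rightarrow> bool" and i and z :: "node \<times> node \<Rightarrow> bool"
  have fin: "finite ?N" by (auto simp: parents_def)
  have disj: "grid_edges t \<inter> ?N = {}" by (auto simp: grid_edges_def)
  have eta: "eta f (\<lambda>e. if e \<in> grid_edges t then z e else z' e) b (Suc t)
      = (\<lambda>i. if i \<in> {..Suc t} then h (eta f z b t) i z' else False)" for z z'
  proof -
    have 1: "eta f (\<lambda>e. if e \<in> grid_edges t then z e else z' e) b t = eta f z b t"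
      by (intro eta_cong) auto
    have 2: "((t, j), (Suc t, k)) \<notin> grid_edges t" for j k
      by (auto simp: grid_edges_def)
    show ?thesis by (auto simp: fun_eq_iff 1 2 h_def)
  qed
  have row: "map_pmf (\<lambda>z i. if i \<in> {..Suc t} then h x i z else False) (Pi_pmf ?N False ?B)
      = bit_row f p t x" for x
  proof -
    have "map_pmf (\<lambda>z i. if i \<in> {..Suc t} then h x i z else False) (Pi_pmf ?N False ?B)
        = Pi_pmf {..Suc t} False (\<lambda>i. map_pmf (h x i) (Pi_pmf (?S i) False ?B))"
      by (intro map_Pi_pmf_blocks)
         (auto simp: parents_def disjoint_family_on_def h_def split: if_splits)
    also have "\<dots> = bit_row f p t x"
      unfolding bit_row_def
    proof (intro Pi_pmf_cong refl)
      fix i assume "i \<in> {..Suc t}"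
      show "map_pmf (h x i) (Pi_pmf (?S i) False ?B)
        = (if i = 0 then map_pmf (\<lambda>z. bsc z (x 0)) (bernoulli_pmf p)
           else if i = Suc t then map_pmf (\<lambda>z. bsc z (x t)) (bernoulli_pmf p)
           else bit_node f p (x (i - 1)) (x i))"
        by (cases i) (auto simp: parents_def h_def[abs_def] bit_node_def Pi_pmf_insert pair_map_pmf1
            pair_map_pmf2 map_pmf_comp case_prod_unfold Pi_pmf_singleton)
    qed
    finally show ?thesis .
  qed
  have "eta_law f p b (Suc t) = map_pmf (\<lambda>(z, z'). eta f (\<lambda>e. if e \<in> grid_edges t then z e else z' e) b (Suc t))
      (pair_pmf (edge_noise p t) (Pi_pmf ?N False ?B))"
    unfolding eta_law_def edge_noise_def grid_edges_Suc
    by (simp only: Pi_pmf_union[OF finite_grid_edges fin disj] map_pmf_comp) (simp add: case_prod_unfold)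
  also have "\<dots> = bind_pmf (edge_noise p t) (\<lambda>z. map_pmf
      (\<lambda>z' i. if i \<in> {..Suc t} then h (eta f z b t) i z' else False) (Pi_pmf ?N False ?B))"
    by (simp only: eta) (simp add: pair_pmf_def map_bind_pmf map_pmf_def bind_assoc_pmf bind_return_pmf)
  also have "\<dots> = bind_pmf (eta_law f p b t) (bit_row f p t)"
    unfolding row eta_law_def by (simp add: bind_map_pmf)
  finally show ?thesis .
qed

section \<open>Coupling through undetermined bits\<close>

text \<open>\<open>None\<close> means that the channel passes its input on, \<open>Some v\<close>
  that it emits the fresh bit \<open>v\<close> instead.\<close>

definition erasure :: "real \<Rightarrow> bool option pmf" where
  "erasure p = bind_pmf (bernoulli_pmf (2 * p))
     (\<lambda>r. if r then map_pmf Some (bernoulli_pmf (1/2)) else return_pmf None)"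

text \<open>In the three-valued rows below, \<^const>\<open>None\<close> marks a bit that may still depend on the origin.\<close>

definition tri_channel :: "real \<Rightarrow> bool option \<Rightarrow> bool option pmf" where
  "tri_channel p s = map_pmf (case_option s Some) (erasure p)"

text \<open>The output is determined exactly when all completions of the undetermined inputs give
  the same value of \<open>f\<close>.\<close>

fun tri_lift :: "(bool \<Rightarrow> bool \<Rightarrow> bool) \<Rightarrow> bool option \<Rightarrow> bool option \<Rightarrow> bool option" where
  "tri_lift f (Some x) (Some y) = Some (f x y)"
| "tri_lift f (Some x) None = (if f x True = f x False then Some (f x True) else None)"
| "tri_lift f None (Some y) = (if f True y = f False y then Some (f True y) else None)"
| "tri_lift f None None =
    (if f True True = f True False \<and> f True False = f False True \<and> f False True = f False False
     then Some (f True True) else None)"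

definition tri_node :: "(bool \<Rightarrow> bool \<Rightarrow> bool) \<Rightarrow> real \<Rightarrow> bool option \<Rightarrow> bool option \<Rightarrow> bool option pmf" where
  "tri_node f p a b = map_pmf (\<lambda>(x, y). tri_lift f x y) (pair_pmf (tri_channel p a) (tri_channel p b))"

definition tri_site :: "(bool \<Rightarrow> bool \<Rightarrow> bool) \<Rightarrow> real \<Rightarrow> nat \<Rightarrow> (nat \<Rightarrow> bool option) \<Rightarrow> nat \<Rightarrow> bool option pmf" where
  "tri_site f p t s i = (if i = 0 then tri_channel p (s 0)
     else if i = Suc t then tri_channel p (s t) else tri_node f p (s (i - 1)) (s i))"

definition tri_row :: "(bool \<Rightarrow> bool \<Rightarrow> bool) \<Rightarrow> real \<Rightarrow> nat \<Rightarrow> (nat \<Rightarrow> bool option) \<Rightarrow> (nat \<Rightarrow> bool option) pmf" where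
  "tri_row f p t s = Pi_pmf {..Suc t} (Some False) (tri_site f p t s)"

text \<open>The origin is \<open>None\<close>, so that one law serves both origin bits.
  \<open>Some False\<close> elsewhere is the three-valued form of the padding in
  \<open>eta\<close>.\<close>

primrec tri_law :: "(bool \<Rightarrow> bool \<Rightarrow> bool) \<Rightarrow> real \<Rightarrow> nat \<Rightarrow> (nat \<Rightarrow> bool option) pmf" where
  "tri_law f p 0 = return_pmf (\<lambda>i. if i = 0 then None else Some False)"
| "tri_law f p (Suc t) = bind_pmf (tri_law f p t) (tri_row f p t)"

lemma finite_set_tri_row: "finite (set_pmf (tri_row f p t s))"
  by (simp add: tri_row_def finite_set_Pi_pmf)

lemma finite_set_tri_law: "finite (set_pmf (tri_law f p t))"
  by (induction t) (auto simp: finite_set_tri_row)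

lemma pmf_erasure:
  assumes "0 \<le> p" "p \<le> 1/2"
  shows "pmf (erasure p) None = 1 - 2 * p" "pmf (erasure p) (Some v) = p"
proof -
  have "pmf (map_pmf Some (bernoulli_pmf (1/2))) None = 0"
    by (rule pmf_map_outside) auto
  moreover have "pmf (map_pmf Some (bernoulli_pmf (1/2))) (Some v) = 1/2" for v
    by (subst pmf_map_inj') (auto simp: inj_def)
  ultimately show "pmf (erasure p) None = 1 - 2 * p" "pmf (erasure p) (Some v) = p"
    using assms by (simp_all add: erasure_def pmf_bind)
qed

lemma sum_UNIV_tri: "(\<Sum>x\<in>UNIV. h x) = h None + (h (Some True) + (h (Some False)))" for h :: "bool option \<Rightarrow> 'a::comm_monoid_add"
proof -
  have *: "(UNIV :: bool option set) = {None, Some True, Some False}"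
    by (auto simp: UNIV_option_conv UNIV_bool)
  show ?thesis unfolding * by simp
qed

lemma expectation_finite_UNIV:
  fixes h :: "'a::finite \<Rightarrow> real"
  shows "measure_pmf.expectation M h = (\<Sum>x\<in>UNIV. pmf M x * h x)"
  by (subst integral_measure_pmf[of UNIV]) auto

lemma pmf_map_finite:
  fixes M :: "'a::finite pmf"
  shows "pmf (map_pmf h M) y = (\<Sum>x\<in>UNIV. pmf M x * of_bool (h x = y))"
  unfolding map_pmf_def pmf_bind expectation_finite_UNIV by (auto simp: pmf_return intro!: sum.cong)

text \<open>A fair bit that replaces the input with probability \<open>2 * p\<close> differs from it
  with probability \<open>p\<close>.\<close>

lemma map_bernoulli_bsc:
  assumes "0 \<le> p" "p \<le> 1/2"
  shows "map_pmf (\<lambda>z. bsc z x) (bernoulli_pmf p) = map_pmf (case_option x id) (erasure p)"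
  by (rule pmf_eqI)
     (use assms in \<open>auto simp: pmf_map_finite sum_UNIV_tri pmf_erasure UNIV_bool bsc_def of_bool_def\<close>)

definition consistent :: "bool option \<Rightarrow> bool \<Rightarrow> bool" where
  "consistent s x \<longleftrightarrow> (\<forall>v. s = Some v \<longrightarrow> x = v)"

lemma consistent_Some [simp]: "consistent (Some v) x \<longleftrightarrow> x = v"
  by (auto simp: consistent_def)

text \<open>Both sides are driven by the same \<open>erasure p\<close>: a fresh bit overwrites both
  inputs, otherwise the consistent inputs pass through.\<close>

lemma rel_tri_channel:
  assumes "0 \<le> p" "p \<le> 1/2" "consistent s x"
  shows "rel_pmf consistent (tri_channel p s) (map_pmf (\<lambda>z. bsc z x) (bernoulli_pmf p))"
  unfolding map_bernoulli_bsc[OF assms(1,2)] tri_channel_def pmf.rel_map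
  by (rule rel_pmf_reflI) (use assms(3) in \<open>auto simp: consistent_def split: option.splits\<close>)

lemma consistent_tri_lift: "consistent a x \<Longrightarrow> consistent b y \<Longrightarrow> consistent (tri_lift f a b) (f x y)"
  by (cases a; cases b; cases x; cases y) (auto simp: consistent_def split: if_splits)

lemma rel_tri_node:
  assumes "0 \<le> p" "p \<le> 1/2" "consistent a x" "consistent b y"
  shows "rel_pmf consistent (tri_node f p a b) (bit_node f p x y)"
proof -
  have bit: "bit_node f p x y = map_pmf (\<lambda>(x, y). f x y)
      (pair_pmf (map_pmf (\<lambda>z. bsc z x) (bernoulli_pmf p)) (map_pmf (\<lambda>z. bsc z y) (bernoulli_pmf p)))"
    by (simp add: bit_node_def pair_map_pmf1 pair_map_pmf2 map_pmf_comp case_prod_unfold)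
  have "rel_pmf (rel_prod consistent consistent) (pair_pmf (tri_channel p a) (tri_channel p b))
      (pair_pmf (map_pmf (\<lambda>z. bsc z x) (bernoulli_pmf p)) (map_pmf (\<lambda>z. bsc z y) (bernoulli_pmf p)))"
    using assms by (simp add: rel_pmf_rel_prod rel_tri_channel)
  then show ?thesis
    unfolding bit tri_node_def pmf.rel_map
    by (rule pmf.rel_mono_strong) (auto intro: consistent_tri_lift)
qed

text \<open>The left law does not mention \<open>b\<close>, so the configurations from both origin
  bits are compared with the same three-valued law.\<close>

lemma rel_tri_law:
  assumes "0 \<le> p" "p \<le> 1/2"
  shows "rel_pmf (\<lambda>s x. \<forall>i. consistent (s i) (x i)) (tri_law f p t) (eta_law f p b t)"
proof (induction t)
  case 0
  have "eta_law f p b 0 = map_pmf (\<lambda>z i. if i = 0 then b else False) (edge_noise p 0)"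
    unfolding eta_law_def by (intro map_pmf_cong refl) (auto simp: fun_eq_iff)
  then show ?case by (auto simp: consistent_def)
next
  case (Suc t)
  show ?case
    unfolding eta_law_Suc tri_law.simps
  proof (rule rel_pmf_bindI[OF Suc])
    fix s :: "nat \<Rightarrow> bool option" and x assume "\<forall>i. consistent (s i) (x i)"
    then show "rel_pmf (\<lambda>s x. \<forall>i. consistent (s i) (x i)) (tri_row f p t s) (bit_row f p t x)"
      unfolding tri_row_def bit_row_def
      using assms by (intro rel_pmf_Pi_pmf) (auto simp: tri_site_def rel_tri_channel rel_tri_node consistent_Some)
  qed
qed

section \<open>Total variation distance and undetermined sites\<close>

lemma tv_dist_le:
  assumes "\<And>A. \<bar>measure_pmf.prob P A - measure_pmf.prob Q A\<bar> \<le> c"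
  shows "tv_dist P Q \<le> c"
  unfolding tv_dist_def using assms by (intro cSUP_least) auto

lemma tv_dist_nonneg: "0 \<le> tv_dist P Q"
proof -
  have "bdd_above (range (\<lambda>A. \<bar>measure_pmf.prob P A - measure_pmf.prob Q A\<bar>))"
  proof (intro bdd_aboveI2)
    fix A
    have "\<bar>a - b\<bar> \<le> 1" if "0 \<le> a" "0 \<le> b" "a \<le> 1" "b \<le> 1" for a b :: real
      using that by linarith
    then show "\<bar>measure_pmf.prob P A - measure_pmf.prob Q A\<bar> \<le> 1"
      by simp
  qed
  then have "\<bar>measure_pmf.prob P {} - measure_pmf.prob Q {}\<bar> \<le> tv_dist P Q"
    unfolding tv_dist_def by (intro cSUP_upper) auto
  then show ?thesis by simp
qed

text \<open>A fully determined row equals the configuration coupled to it. With \<open>T\<close> the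
  determined rows that lie in \<open>A\<close>, the probability of \<open>A\<close> is between that
  of \<open>T\<close> and that of \<open>T\<close> plus \<open>?u\<close>, for either origin
  bit.\<close>

lemma tv_dist_eta_law_le:
  assumes "0 \<le> p" "p \<le> 1/2"
  shows "tv_dist (eta_law f p b t) (eta_law f p b' t) \<le> measure_pmf.prob (tri_law f p t) {s. \<exists>i. s i = None}"
    (is "_ \<le> ?u")
proof (rule tv_dist_le)
  fix A
  let ?R = "\<lambda>(s :: nat \<Rightarrow> bool option) x. \<forall>i. consistent (s i) (x i)"
  define T where "T = {s :: nat \<Rightarrow> bool option. (\<forall>i. s i \<noteq> None) \<and> the \<circ> s \<in> A}"
  have det: "x = the \<circ> s" if "?R s x" "\<forall>i. s i \<noteq> None" for s x
    using that by (fastforce simp: consistent_def fun_eq_iff)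
  have lower: "measure_pmf.prob (tri_law f p t) T \<le> measure_pmf.prob (eta_law f p c t) A" for c
  proof -
    have "measure_pmf.prob (tri_law f p t) T \<le> measure_pmf.prob (eta_law f p c t) {x. \<exists>s\<in>T. ?R s x}"
      by (rule rel_pmf_measureD[OF rel_tri_law[OF assms]])
    also have "\<dots> \<le> measure_pmf.prob (eta_law f p c t) A"
      using det by (intro measure_pmf.finite_measure_mono) (auto simp: T_def)
    finally show ?thesis .
  qed
  have upper: "measure_pmf.prob (eta_law f p c t) A \<le> measure_pmf.prob (tri_law f p t) T + ?u" for c
  proof -
    have "rel_pmf (\<lambda>x s. ?R s x) (eta_law f p c t) (tri_law f p t)"
      using rel_tri_law[OF assms, of f t c] pmf.rel_flip[of ?R] by (simp add: conversep_iff[abs_def])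
    then have "measure_pmf.prob (eta_law f p c t) A
        \<le> measure_pmf.prob (tri_law f p t) {s. \<exists>x\<in>A. ?R s x}"
      by (rule rel_pmf_measureD)
    also have "\<dots> \<le> measure_pmf.prob (tri_law f p t) (T \<union> {s. \<exists>i. s i = None})"
      using det by (intro measure_pmf.finite_measure_mono) (auto simp: T_def)
    also have "\<dots> \<le> measure_pmf.prob (tri_law f p t) T + ?u"
      by (intro measure_Un_le) auto
    finally show ?thesis .
  qed
  show "\<bar>measure_pmf.prob (eta_law f p b t) A - measure_pmf.prob (eta_law f p b' t) A\<bar> \<le> ?u"
    using lower[of b] lower[of b'] upper[of b] upper[of b'] by linarith
qed

lemma tri_law_outside: "s \<in> set_pmf (tri_law f p t) \<Longrightarrow> i > t \<Longrightarrow> s i = Some False"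
proof (cases t)
  case (Suc t')
  assume "s \<in> set_pmf (tri_law f p t)" "i > t"
  then obtain s' where "s \<in> set_pmf (tri_row f p t' s')" by (auto simp: Suc)
  with set_Pi_pmf_subset[of "{..Suc t'}" "Some False" "tri_site f p t' s'"] \<open>i > t\<close>
  show ?thesis by (auto simp: tri_row_def Suc)
qed auto

definition undet :: "(bool \<Rightarrow> bool \<Rightarrow> bool) \<Rightarrow> real \<Rightarrow> nat \<Rightarrow> nat \<Rightarrow> real" where
  "undet f p t i = measure_pmf.prob (tri_law f p t) {s. s i = None}"

lemma prob_undet_le_sum:
  "measure_pmf.prob (tri_law f p t) {s. \<exists>i. s i = None} \<le> (\<Sum>i\<le>t. undet f p t i)"
proof -
  have "measure_pmf.prob (tri_law f p t) {s. \<exists>i. s i = None}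
      \<le> measure_pmf.prob (tri_law f p t) (\<Union>i\<in>{..t}. {s. s i = None})"
  proof (rule measure_pmf.finite_measure_mono_AE, unfold AE_measure_pmf_iff, intro ballI impI)
    fix s assume s: "s \<in> set_pmf (tri_law f p t)" "s \<in> {s. \<exists>i. s i = None}"
    then obtain i where "s i = None" by auto
    with tri_law_outside[OF s(1), of i] have "i \<le> t" by (cases "i > t") auto
    with \<open>s i = None\<close> show "s \<in> (\<Union>i\<in>{..t}. {s. s i = None})" by auto
  qed simp
  also have "\<dots> \<le> (\<Sum>i\<le>t. undet f p t i)"
    unfolding undet_def by (intro measure_pmf.finite_measure_subadditive_finite) auto
  finally show ?thesis .
qed

lemma tv_tendsto_0I:
  assumes "0 \<le> p" "p \<le> 1/2" "(\<lambda>t. \<Sum>i\<le>t. undet f p t i) \<longlonglongrightarrow> 0"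
  shows "(\<lambda>t. tv_dist (eta_law f p b t) (eta_law f p b' t)) \<longlonglongrightarrow> 0"
proof (rule tendsto_sandwich[OF _ _ tendsto_const assms(3)])
  show "\<forall>\<^sub>F t in sequentially. tv_dist (eta_law f p b t) (eta_law f p b' t) \<le> (\<Sum>i\<le>t. undet f p t i)"
    using order_trans[OF tv_dist_eta_law_le[OF assms(1,2)] prob_undet_le_sum] by (intro always_eventually) auto
qed (simp add: tv_dist_nonneg)

section \<open>Potentials on windows of three sites\<close>

lemma map_Pi_pmf_three:
  assumes "finite A" "i \<in> A" "j \<in> A" "k \<in> A" "i \<noteq> j" "i \<noteq> k" "j \<noteq> k"
  shows "map_pmf (\<lambda>s. (s i, s j, s k)) (Pi_pmf A d P) = pair_pmf (P i) (pair_pmf (P j) (P k))"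
proof -
  define B where "B = A - {i, j, k}"
  have A: "A = insert i (insert j (insert k B))" "i \<notin> insert j (insert k B)" "j \<notin> insert k B" "k \<notin> B" "finite B"
    using assms by (auto simp: B_def)
  show ?thesis
    unfolding A(1) using A(2-) assms(5-)
    by (simp add: Pi_pmf_insert' map_bind_pmf pair_pmf_def bind_assoc_pmf bind_return_pmf)
qed

lemma sum_UNIV_prod:
  "(\<Sum>x\<in>UNIV. h x) = (\<Sum>a\<in>UNIV. \<Sum>b\<in>UNIV. h (a, b))"
  for h :: "'a::finite \<times> 'b::finite \<Rightarrow> 'c::comm_monoid_add"
  by (simp only: UNIV_Times_UNIV[symmetric] sum.cartesian_product) simp

lemma expectation_Pi_pmf_three:
  fixes P :: "'a \<Rightarrow> 'b::finite pmf" and w :: "'b \<Rightarrow> 'b \<Rightarrow> 'b \<Rightarrow> real"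
  assumes "finite A" "i \<in> A" "j \<in> A" "k \<in> A" "i \<noteq> j" "i \<noteq> k" "j \<noteq> k"
  shows "measure_pmf.expectation (Pi_pmf A d P) (\<lambda>s. w (s i) (s j) (s k))
       = (\<Sum>x\<in>UNIV. \<Sum>y\<in>UNIV. \<Sum>z\<in>UNIV. pmf (P i) x * pmf (P j) y * pmf (P k) z * w x y z)"
proof -
  have "measure_pmf.expectation (Pi_pmf A d P) (\<lambda>s. w (s i) (s j) (s k))
      = measure_pmf.expectation (map_pmf (\<lambda>s. (s i, s j, s k)) (Pi_pmf A d P)) (\<lambda>(x, y, z). w x y z)"
    by simp
  also have "\<dots> = (\<Sum>x\<in>UNIV. \<Sum>y\<in>UNIV. \<Sum>z\<in>UNIV. pmf (P i) x * pmf (P j) y * pmf (P k) z * w x y z)"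
    unfolding map_Pi_pmf_three[OF assms] expectation_finite_UNIV sum_UNIV_prod
    by (simp add: pmf_pair mult.assoc)
  finally show ?thesis .
qed

text \<open>Once \<open>b\<close> is below \<open>\<epsilon> / 2 * (1 - \<rho>)\<close>, the
  recursion is dominated by an affine map with fixed point \<open>\<epsilon> / 2\<close>, and the
  excess over it decays like \<open>\<rho> ^ n\<close>.\<close>

lemma tendsto_0_if_contraction:
  fixes a b :: "nat \<Rightarrow> real"
  assumes "\<And>n. 0 \<le> a n" "0 \<le> \<rho>" "\<rho> < 1" "b \<longlonglongrightarrow> 0"
    and step: "\<And>n. n \<ge> N \<Longrightarrow> a (Suc n) \<le> \<rho> * a n + b n"
  shows "a \<longlonglongrightarrow> 0"
proof (rule LIMSEQ_I)
  fix \<epsilon> :: real assume \<epsilon>: "0 < \<epsilon>"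
  have "\<forall>\<^sub>F n in sequentially. b n < \<epsilon> / 2 * (1 - \<rho>)"
    using assms(3,4) \<epsilon> by (intro order_tendstoD) auto
  then obtain K where K: "\<And>n. n \<ge> K \<Longrightarrow> b n < \<epsilon> / 2 * (1 - \<rho>)"
    by (auto simp: eventually_sequentially)
  define M where "M = max K N"
  have geo: "a (M + n) \<le> \<epsilon> / 2 + \<rho> ^ n * a M" for n
  proof (induction n)
    case (Suc n)
    have "a (M + Suc n) \<le> \<rho> * a (M + n) + \<epsilon> / 2 * (1 - \<rho>)"
      using step[of "M + n"] K[of "M + n"] by (simp add: M_def le_max_iff_disj trans_le_add1)
    also have "\<dots> \<le> \<rho> * (\<epsilon> / 2 + \<rho> ^ n * a M) + \<epsilon> / 2 * (1 - \<rho>)"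
      using Suc assms(2) by (intro add_right_mono mult_left_mono)
    also have "\<dots> = \<epsilon> / 2 + \<rho> ^ Suc n * a M" by (simp add: field_simps)
    finally show ?case .
  qed (use \<epsilon> in simp)
  have "(\<lambda>n. \<rho> ^ n * a M) \<longlonglongrightarrow> 0 * a M"
    using assms(2,3) by (intro tendsto_mult tendsto_const LIMSEQ_power_zero) auto
  then have "\<forall>\<^sub>F n in sequentially. \<rho> ^ n * a M < \<epsilon> / 2"
    using \<epsilon> by (intro order_tendstoD) auto
  then obtain m where m: "\<And>n. n \<ge> m \<Longrightarrow> \<rho> ^ n * a M < \<epsilon> / 2"
    by (auto simp: eventually_sequentially)
  show "\<exists>no. \<forall>n\<ge>no. norm (a n - 0) < \<epsilon>"
  proof (intro exI allI impI)
    fix n assume n: "n \<ge> M + m"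
    then have "m \<le> n - M" by simp
    with geo[of "n - M"] m[of "n - M"] n have "a n < \<epsilon>" by simp
    then show "norm (a n - 0) < \<epsilon>" using assms(1)[of n] by simp
  qed
qed

lemma pmf_tri_channel:
  assumes "0 \<le> p" "p \<le> 1/2"
  shows "pmf (tri_channel p s) k =
    (case s of None \<Rightarrow> (if k = None then 1 - 2 * p else p)
     | Some v \<Rightarrow> (if k = Some v then 1 - p else if k = None then 0 else p))"
  unfolding tri_channel_def pmf_map_finite sum_UNIV_tri
  by (cases s; cases k; cases "the s"; cases "the k") (simp_all add: pmf_erasure[OF assms])

lemma pmf_tri_node:
  "pmf (tri_node f p a b) k = (\<Sum>x\<in>UNIV. \<Sum>y\<in>UNIV.
     pmf (tri_channel p a) x * pmf (tri_channel p b) y * of_bool (tri_lift f x y = k))"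
  unfolding tri_node_def pmf_map_finite sum_UNIV_prod
  by (simp add: pmf_pair)

text \<open>An undetermined output needs an undetermined message on at least one of the two edges,
  so a union bound applies.\<close>

lemma pmf_tri_node_None_le:
  assumes "0 \<le> p" "p \<le> 1/2"
  shows "pmf (tri_node f p a b) None \<le> (1 - 2 * p) * (of_bool (a = None) + of_bool (b = None))"
proof -
  have marg: "pmf (tri_channel p s) None = (1 - 2 * p) * of_bool (s = None)" for s
    using assms by (simp add: pmf_tri_channel split: option.split)
  have "pmf (tri_node f p a b) None \<le> measure_pmf.prob (pair_pmf (tri_channel p a) (tri_channel p b))
      (fst -` {None} \<union> snd -` {None})"
    unfolding tri_node_def pmf_map
    by (intro measure_pmf.finite_measure_mono) (auto elim: tri_lift.elims split: if_splits)
  also have "\<dots> \<le> measure_pmf.prob (pair_pmf (tri_channel p a) (tri_channel p b)) (fst -` {None})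
      + measure_pmf.prob (pair_pmf (tri_channel p a) (tri_channel p b)) (snd -` {None})"
    by (intro measure_Un_le) auto
  also have "\<dots> = pmf (tri_channel p a) None + pmf (tri_channel p b) None"
    unfolding pmf_map[symmetric] map_fst_pair_pmf map_snd_pair_pmf ..
  finally show ?thesis by (simp add: marg distrib_left)
qed

lemma integrable_tri_law: "integrable (measure_pmf (tri_law f p t)) (h :: _ \<Rightarrow> real)"
  by (intro integrable_measure_pmf_finite finite_set_tri_law)

lemma integrable_tri_row: "integrable (measure_pmf (tri_row f p t s)) (h :: _ \<Rightarrow> real)"
  by (intro integrable_measure_pmf_finite finite_set_tri_row)

lemma expectation_tri_law_Suc:
  fixes h :: "_ \<Rightarrow> real"
  shows "measure_pmf.expectation (tri_law f p (Suc t)) h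
       = measure_pmf.expectation (tri_law f p t) (\<lambda>s. measure_pmf.expectation (tri_row f p t s) h)"
  by (simp add: expectation_bind_pmf_finite finite_set_tri_law finite_set_tri_row)

lemma undet_eq_expectation:
  "undet f p t i = measure_pmf.expectation (tri_law f p t) (\<lambda>s. of_bool (s i = None))"
proof -
  have "(\<lambda>s :: nat \<Rightarrow> bool option. of_bool (s i = None)) = indicat_real {s. s i = None}"
    by (auto simp: fun_eq_iff)
  then show ?thesis by (simp add: undet_def)
qed

lemma undet_nonneg: "0 \<le> undet f p t i"
  by (simp add: undet_def)

lemma expectation_tri_row_None:
  assumes "i \<le> Suc t"
  shows "measure_pmf.expectation (tri_row f p t s) (\<lambda>s'. of_bool (s' i = None)) = pmf (tri_site f p t s i) None"
proof -
  have "measure_pmf.expectation (tri_row f p t s) (\<lambda>s'. of_bool (s' i = None) :: real)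
      = measure_pmf.expectation (map_pmf (\<lambda>s'. s' i) (tri_row f p t s)) (\<lambda>x. of_bool (x = None))"
    by simp
  also have "\<dots> = measure_pmf.expectation (tri_site f p t s i) (\<lambda>x. of_bool (x = None))"
    using assms by (simp only: tri_row_def) (simp add: Pi_pmf_component)
  also have "\<dots> = pmf (tri_site f p t s i) None"
    by (simp add: expectation_finite_UNIV sum_UNIV_tri)
  finally show ?thesis .
qed

lemma undet_Suc:
  assumes "i \<le> Suc t"
  shows "undet f p (Suc t) i = measure_pmf.expectation (tri_law f p t) (\<lambda>s. pmf (tri_site f p t s i) None)"
  unfolding undet_eq_expectation expectation_tri_law_Suc expectation_tri_row_None[OF assms] ..

section \<open>Sites at a fixed distance from a boundary\<close>

lemma undet_boundary:
  assumes "0 \<le> p" "p \<le> 1/2"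
  shows "undet f p (Suc t) 0 = (1 - 2 * p) * undet f p t 0"
    and "undet f p (Suc t) (Suc t) = (1 - 2 * p) * undet f p t t"
proof -
  have marg: "pmf (tri_channel p s) None = (1 - 2 * p) * of_bool (s = None)" for s
    using assms by (simp add: pmf_tri_channel split: option.split)
  show "undet f p (Suc t) 0 = (1 - 2 * p) * undet f p t 0"
    and "undet f p (Suc t) (Suc t) = (1 - 2 * p) * undet f p t t"
    by (simp_all add: undet_Suc tri_site_def marg undet_eq_expectation[of f p t])
qed

lemma undet_interior:
  assumes "0 \<le> p" "p \<le> 1/2" "0 < i" "i \<le> t"
  shows "undet f p (Suc t) i \<le> (1 - 2 * p) * (undet f p t (i - 1) + undet f p t i)"
proof -
  have "undet f p (Suc t) i = measure_pmf.expectation (tri_law f p t) (\<lambda>s. pmf (tri_node f p (s (i - 1)) (s i)) None)"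
    using assms(3,4) by (simp add: undet_Suc tri_site_def)
  also have "\<dots> \<le> measure_pmf.expectation (tri_law f p t)
      (\<lambda>s. (1 - 2 * p) * (of_bool (s (i - 1) = None) + of_bool (s i = None)))"
    by (intro integral_mono integrable_tri_law pmf_tri_node_None_le assms)
  also have "\<dots> = (1 - 2 * p) * (undet f p t (i - 1) + undet f p t i)"
    by (simp add: undet_eq_expectation integrable_tri_law del: of_bool_eq_iff)
  finally show ?thesis .
qed

text \<open>Induction over columns: column \<open>Suc k\<close> feeds itself with factor
  \<open>1 - 2 * p\<close>, and its other parent, column \<open>k\<close>, is a forcing term that
  already tends to 0.\<close>

lemma undet_left_tendsto_0:
  assumes "0 < p" "p \<le> 1/2"
  shows "(\<lambda>t. undet f p t k) \<longlonglongrightarrow> 0"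
proof (induction k)
  case 0
  show ?case
    by (rule tendsto_0_if_contraction[where \<rho> = "1 - 2 * p" and b = "\<lambda>_. 0" and N = 0])
       (use assms in \<open>auto simp: undet_nonneg undet_boundary\<close>)
next
  case (Suc k)
  have lim: "(\<lambda>t. (1 - 2 * p) * undet f p t k) \<longlonglongrightarrow> 0"
    using tendsto_mult_left[OF Suc, of "1 - 2 * p"] by simp
  show ?case
  proof (rule tendsto_0_if_contraction[OF _ _ _ lim, where \<rho> = "1 - 2 * p" and N = "Suc k"])
    fix t assume "Suc k \<le> t"
    then show "undet f p (Suc t) (Suc k) \<le> (1 - 2 * p) * undet f p t (Suc k) + (1 - 2 * p) * undet f p t k"
      using undet_interior[of p "Suc k" t f] assms by (simp add: algebra_simps)
  qed (use assms in \<open>auto simp: undet_nonneg\<close>)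
qed

lemma undet_right_tendsto_0:
  assumes "0 < p" "p \<le> 1/2"
  shows "(\<lambda>t. undet f p t (t - k)) \<longlonglongrightarrow> 0"
proof (induction k)
  case 0
  show ?case
    by (rule tendsto_0_if_contraction[where \<rho> = "1 - 2 * p" and b = "\<lambda>_. 0" and N = 0])
       (use assms in \<open>auto simp: undet_nonneg undet_boundary\<close>)
next
  case (Suc k)
  have lim: "(\<lambda>t. (1 - 2 * p) * undet f p t (t - k)) \<longlonglongrightarrow> 0"
    using tendsto_mult_left[OF Suc, of "1 - 2 * p"] by simp
  show ?case
  proof (rule tendsto_0_if_contraction[OF _ _ _ lim, where \<rho> = "1 - 2 * p" and N = "Suc k"])
    fix t assume "Suc k \<le> t"
    \<comment> \<open>Position \<open>t - k\<close> has distance \<open>Suc k\<close> from the right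
      end of row \<open>Suc t\<close>. In row \<open>t\<close> its left parent has the same distance
      and its right parent has distance \<open>k\<close>.\<close>
    then show "undet f p (Suc t) (Suc t - Suc k)
        \<le> (1 - 2 * p) * undet f p t (t - Suc k) + (1 - 2 * p) * undet f p t (t - k)"
      using undet_interior[of p "t - k" t f] assms by (simp add: algebra_simps)
  qed (use assms in \<open>auto simp: undet_nonneg\<close>)
qed

text \<open>The function \<open>g\<close> telescopes along a row, so that only the sum over all windows of \<open>w\<close> needs to contract.\<close>

definition potential :: "(bool \<Rightarrow> bool \<Rightarrow> bool) \<Rightarrow> real \<Rightarrow> real
    \<Rightarrow> (bool option \<Rightarrow> bool option \<Rightarrow> bool option \<Rightarrow> real)
    \<Rightarrow> (bool option \<Rightarrow> bool option \<Rightarrow> bool option \<Rightarrow> real) \<Rightarrow> bool" where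
  "potential f p \<rho> w g \<longleftrightarrow>
    (\<forall>a b c. of_bool (b = None) \<le> w a b c) \<and>
    (\<forall>a b c. w (Some a) (Some b) (Some c) = 0 \<and> g (Some a) (Some b) (Some c) = 0) \<and>
    (\<forall>a b c d. (\<Sum>x\<in>UNIV. \<Sum>y\<in>UNIV. \<Sum>z\<in>UNIV.
        pmf (tri_node f p a b) x * pmf (tri_node f p b c) y * pmf (tri_node f p c d) z * w x y z)
      \<le> \<rho> * w a b c - g a b c + g b c d)"

text \<open>There are finitely many windows, so the sum of all absolute values serves as the
  constant. This bounds windows at the ends of a row by probabilities of undetermined sites.\<close>

lemma window_bound:
  fixes h :: "bool option \<Rightarrow> bool option \<Rightarrow> bool option \<Rightarrow> real"
  assumes "\<And>a b c. h (Some a) (Some b) (Some c) = 0"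
  shows "\<exists>C\<ge>0. \<forall>a b c. \<bar>h a b c\<bar> \<le> C * (of_bool (a = None) + of_bool (b = None) + of_bool (c = None))"
proof (intro exI conjI allI)
  let ?C = "\<Sum>a\<in>UNIV. \<Sum>b\<in>UNIV. \<Sum>c\<in>UNIV. \<bar>h a b c\<bar>"
  show "0 \<le> ?C" by (intro sum_nonneg) auto
  fix a b c
  have "\<bar>h a b c\<bar> \<le> (\<Sum>c\<in>UNIV. \<bar>h a b c\<bar>)" by (intro member_le_sum) auto
  also have "\<dots> \<le> (\<Sum>b\<in>UNIV. \<Sum>c\<in>UNIV. \<bar>h a b c\<bar>)"
    by (intro member_le_sum[of b _ "\<lambda>b. \<Sum>c\<in>UNIV. \<bar>h a b c\<bar>"] sum_nonneg) auto
  also have "\<dots> \<le> ?C"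
    by (intro member_le_sum[of a _ "\<lambda>a. \<Sum>b\<in>UNIV. \<Sum>c\<in>UNIV. \<bar>h a b c\<bar>"] sum_nonneg) auto
  finally have le: "\<bar>h a b c\<bar> \<le> ?C" .
  show "\<bar>h a b c\<bar> \<le> ?C * (of_bool (a = None) + of_bool (b = None) + of_bool (c = None))"
  proof (cases "a = None \<or> b = None \<or> c = None")
    case True
    then have "?C * 1 \<le> ?C * (of_bool (a = None) + of_bool (b = None) + of_bool (c = None))"
      using \<open>0 \<le> ?C\<close> by (intro mult_left_mono) auto
    with le show ?thesis by linarith
  qed (use assms in auto)
qed

lemma expectation_tri_row_interior:
  fixes w :: "bool option \<Rightarrow> bool option \<Rightarrow> bool option \<Rightarrow> real"
  assumes "j + 3 \<le> t"
  shows "measure_pmf.expectation (tri_row f p t s) (\<lambda>s'. w (s' (j + 1)) (s' (j + 2)) (s' (j + 3)))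
    = (\<Sum>x\<in>UNIV. \<Sum>y\<in>UNIV. \<Sum>z\<in>UNIV. pmf (tri_node f p (s j) (s (j + 1))) x
        * pmf (tri_node f p (s (j + 1)) (s (j + 2))) y * pmf (tri_node f p (s (j + 2)) (s (j + 3))) z * w x y z)"
proof -
  have site: "tri_site f p t s (Suc i) = tri_node f p (s i) (s (Suc i))" if "Suc i \<le> t" for i
    using that by (simp add: tri_site_def)
  show ?thesis
    unfolding tri_row_def using assms
    by (subst expectation_Pi_pmf_three) (simp_all add: site numeral_2_eq_2 numeral_3_eq_3)
qed

text \<open>Sum \<open>w\<close> over the windows of a row. Interior windows contract by
  \<open>\<rho>\<close> and the terms \<open>g\<close> telescope. What remains sits at the two ends
  of the row, where sites become determined.\<close>

lemma tv_tendsto_0_if_potential: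
  assumes p: "0 < p" "p \<le> 1/2" and \<rho>: "0 \<le> \<rho>" "\<rho> < 1" and pot: "potential f p \<rho> w g"
  shows "(\<lambda>t. tv_dist (eta_law f p b t) (eta_law f p b' t)) \<longlonglongrightarrow> 0"
proof (rule tv_tendsto_0I)
  have w_ge: "of_bool (y = None) \<le> w x y z" for x y z
    using pot by (auto simp: potential_def)
  have w_nonneg: "0 \<le> w x y z" for x y z
    using w_ge[of y x z] by (cases "y = None") auto
  let ?n = "\<lambda>x :: bool option. of_bool (x = None) :: real"
  obtain C1 where C1: "\<And>x y z. \<bar>w x y z\<bar> \<le> C1 * (?n x + ?n y + ?n z)"
    using window_bound[of w] pot by (auto simp: potential_def)
  obtain C2 where C2: "\<And>x y z. \<bar>g x y z\<bar> \<le> C2 * (?n x + ?n y + ?n z)"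
    using window_bound[of g] pot by (auto simp: potential_def)
  define \<Phi> where "\<Phi> t s = (\<Sum>i<t-1. w (s i) (s (i + 1)) (s (i + 2)))" for t and s :: "nat \<Rightarrow> bool option"
  define F where "F t = measure_pmf.expectation (tri_law f p t) (\<Phi> t)" for t
  define L where "L t = undet f p t 0 + undet f p t 1 + undet f p t 2" for t
  define R where "R t = undet f p t (t - 2) + undet f p t (t - 1) + undet f p t (t - 0)" for t
  \<comment> \<open>\<open>C2\<close> pays for \<open>g\<close> at the two ends of row
    \<open>t\<close>, left over from telescoping. \<open>C1\<close> pays for the first and last
    window of row \<open>Suc t\<close>, which contain a boundary site and so escape the inequality
    in \<open>potential\<close>.\<close>
  define D where "D t = C2 * L t + C2 * R t + C1 * L (Suc t) + C1 * R (Suc t)" for t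
  have "L \<longlonglongrightarrow> 0 + 0 + 0" unfolding L_def by (intro tendsto_add undet_left_tendsto_0 p)
  moreover have "R \<longlonglongrightarrow> 0 + 0 + 0" unfolding R_def by (intro tendsto_add undet_right_tendsto_0 p)
  ultimately have LR: "L \<longlonglongrightarrow> 0" "R \<longlonglongrightarrow> 0" by simp_all
  have "D \<longlonglongrightarrow> C2 * 0 + C2 * 0 + C1 * 0 + C1 * 0"
    unfolding D_def by (intro tendsto_intros LR LIMSEQ_Suc)
  then have D: "D \<longlonglongrightarrow> 0" by simp
  have F_nonneg: "0 \<le> F t" for t
    unfolding F_def \<Phi>_def by (intro integral_nonneg_AE always_eventually allI sum_nonneg w_nonneg)
  have step: "F (Suc t) \<le> \<rho> * F t + D t" if t: "3 \<le> t" for t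
  proof -
    define E where "E s h = measure_pmf.expectation (tri_row f p t s) h" for s and h :: "_ \<Rightarrow> real"
    define W where "W i s = w (s i) (s (i + 1)) (s (i + 2))" for i and s :: "nat \<Rightarrow> bool option"
    define N where "N i s = ?n (s i) + ?n (s (i + 1)) + ?n (s (i + 2))" for i and s :: "nat \<Rightarrow> bool option"
    have EW: "E s (W i) \<le> C1 * E s (N i)" for s i
    proof -
      have "E s (W i) \<le> E s (\<lambda>s. C1 * N i s)"
        unfolding E_def W_def N_def
        by (intro integral_mono integrable_tri_row order_trans[OF abs_ge_self C1])
      then show ?thesis by (simp add: E_def)
    qed
    \<comment> \<open>The parents of window \<open>Suc j\<close> in the new row are the positions
      \<open>j\<close> to \<open>j + 3\<close>, the four sites in \<open>potential\<close>.\<close>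
    have int: "E s (W (Suc j)) \<le> \<rho> * W j s - g (s j) (s (j + 1)) (s (j + 2))
        + g (s (Suc j)) (s (Suc j + 1)) (s (Suc j + 2))" if "j < t - 2" for s j
    proof -
      have "E s (W (Suc j)) = measure_pmf.expectation (tri_row f p t s)
          (\<lambda>s'. w (s' (j + 1)) (s' (j + 2)) (s' (j + 3)))"
        by (simp add: E_def W_def[abs_def] numeral_2_eq_2 numeral_3_eq_3)
      also have "\<dots> \<le> \<rho> * W j s - g (s j) (s (j + 1)) (s (j + 2)) + g (s (j + 1)) (s (j + 2)) (s (j + 3))"
        using that pot unfolding W_def
        by (subst expectation_tri_row_interior) (auto simp: potential_def)
      finally show ?thesis by (simp add: numeral_2_eq_2 numeral_3_eq_3)
    qed
    have row: "E s (\<Phi> (Suc t)) \<le> \<rho> * \<Phi> t s + C2 * N 0 s + C2 * N (t - 2) s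
        + C1 * E s (N 0) + C1 * E s (N (t - 1))" for s
    proof -
      let ?G = "\<lambda>j. g (s j) (s (j + 1)) (s (j + 2))"
      have "E s (\<Phi> (Suc t)) = (\<Sum>i<t. E s (W i))"
        unfolding E_def \<Phi>_def W_def by (simp add: integrable_tri_row)
      also have "\<dots> = E s (W 0) + (\<Sum>j<t-2. E s (W (Suc j))) + E s (W (t - 1))"
      proof -
        obtain m where m: "t = Suc (Suc m)"
          using t by (intro that[of "t - 2"]) simp
        show ?thesis unfolding m by (subst sum.lessThan_Suc, subst sum.lessThan_Suc_shift) simp
      qed
      finally have split: "E s (\<Phi> (Suc t)) = E s (W 0) + (\<Sum>j<t-2. E s (W (Suc j))) + E s (W (t - 1))" .
      have "(\<Sum>j<t-2. E s (W (Suc j))) \<le> (\<Sum>j<t-2. \<rho> * W j s + (?G (Suc j) - ?G j))"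
        using int by (intro sum_mono) (auto simp: algebra_simps)
      also have "\<dots> = \<rho> * (\<Sum>j<t-2. W j s) + (?G (t - 2) - ?G 0)"
        unfolding sum.distrib sum_distrib_left by (subst sum_lessThan_telescope[of ?G]) simp
      finally have "(\<Sum>j<t-2. E s (W (Suc j))) \<le> \<rho> * (\<Sum>j<t-2. W j s) + (?G (t - 2) - ?G 0)" .
      \<comment> \<open>Row \<open>t\<close> has \<open>t - 1\<close> windows, one more than the sum
        covers; \<open>w\<close> is nonnegative.\<close>
      moreover have "\<rho> * (\<Sum>j<t-2. W j s) \<le> \<rho> * \<Phi> t s"
        unfolding \<Phi>_def W_def by (intro mult_left_mono sum_mono2 \<rho>) (auto simp: w_nonneg)
      moreover have "\<bar>?G i\<bar> \<le> C2 * N i s" for i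
        unfolding N_def by (rule C2)
      note this[of "t - 2"] this[of 0]
      ultimately show ?thesis
        unfolding split using EW[of s 0] EW[of s "t - 1"] by linarith
    qed
    have N: "measure_pmf.expectation (tri_law f p t') (N i) = undet f p t' i + undet f p t' (i + 1) + undet f p t' (i + 2)" for t' i
      unfolding N_def undet_eq_expectation by (simp add: integrable_tri_law)
    have "F (Suc t) = measure_pmf.expectation (tri_law f p t) (\<lambda>s. E s (\<Phi> (Suc t)))"
      unfolding F_def E_def expectation_tri_law_Suc ..
    also have "\<dots> \<le> measure_pmf.expectation (tri_law f p t) (\<lambda>s. \<rho> * \<Phi> t s + C2 * N 0 s + C2 * N (t - 2) s
        + C1 * E s (N 0) + C1 * E s (N (t - 1)))"
      by (intro integral_mono integrable_tri_law row)
    also have "\<dots> = \<rho> * F t + C2 * measure_pmf.expectation (tri_law f p t) (N 0)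
        + C2 * measure_pmf.expectation (tri_law f p t) (N (t - 2))
        + C1 * measure_pmf.expectation (tri_law f p (Suc t)) (N 0)
        + C1 * measure_pmf.expectation (tri_law f p (Suc t)) (N (t - 1))"
      unfolding expectation_tri_law_Suc E_def F_def by (simp add: integrable_tri_law)
    also have "\<dots> = \<rho> * F t + D t"
    proof -
      have "t - 2 + 1 = t - 1" "t - 2 + 2 = t" "t - 1 + 1 = t" "t - 1 + 2 = Suc t" "Suc t - 2 = t - 1"
        using t by auto
      then show ?thesis unfolding N D_def L_def R_def by (simp add: numeral_2_eq_2)
    qed
    finally show ?thesis .
  qed
  have F: "F \<longlonglongrightarrow> 0"
    by (rule tendsto_0_if_contraction[OF F_nonneg \<rho> D step])
  have bound: "(\<Sum>i\<le>t. undet f p t i) \<le> L t + R t + F t" if "1 \<le> t" for t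
  proof -
    obtain m where m: "t = Suc m" using \<open>1 \<le> t\<close> by (cases t) auto
    have "(\<Sum>i\<le>t. undet f p t i) = undet f p t 0 + (\<Sum>i<t-1. undet f p t (i + 1)) + undet f p t t"
      unfolding m sum.atMost_Suc_shift by (simp add: lessThan_Suc_atMost[symmetric])
    also have "(\<Sum>i<t-1. undet f p t (i + 1)) = measure_pmf.expectation (tri_law f p t) (\<lambda>s. \<Sum>i<t-1. ?n (s (i + 1)))"
      unfolding undet_eq_expectation by (intro Bochner_Integration.integral_sum[symmetric] integrable_tri_law)
    \<comment> \<open>\<open>w\<close> dominates the indicator of its middle site only, so
      \<open>F\<close> covers positions 1 to \<open>t - 1\<close>; positions 0 and \<open>t\<close>
      are left to \<open>L\<close> and \<open>R\<close>.\<close>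
    also have "\<dots> \<le> F t"
      unfolding F_def \<Phi>_def by (intro integral_mono integrable_tri_law sum_mono w_ge)
    finally show ?thesis
      unfolding L_def R_def using undet_nonneg[of f p t] by (smt (verit) diff_zero)
  qed
  show "(\<lambda>t. \<Sum>i\<le>t. undet f p t i) \<longlonglongrightarrow> 0"
  proof (rule tendsto_sandwich[OF _ _ tendsto_const])
    show "\<forall>\<^sub>F t in sequentially. (\<Sum>i\<le>t. undet f p t i) \<le> L t + R t + F t"
      using bound by (auto simp: eventually_sequentially)
    show "(\<lambda>t. L t + R t + F t) \<longlonglongrightarrow> 0"
      using tendsto_add[OF tendsto_add[OF LR] F] by simp
  qed (auto intro!: always_eventually sum_nonneg undet_nonneg)
qed (use p in auto)

section \<open>Symmetries of potentials\<close>

lemma forall_tri: "(\<forall>x. P x) \<longleftrightarrow> P None \<and> P (Some True) \<and> P (Some False)" for P :: "bool option \<Rightarrow> bool"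
  by (auto, metis (full_types) not_None_eq)

lemma sum_pmf_UNIV: "(\<Sum>x\<in>UNIV. pmf M x) = 1" for M :: "'a::finite pmf"
  by (rule sum_pmf_eq_1) auto

lemma pmf_tri_channel_map_Not:
  assumes "0 \<le> p" "p \<le> 1/2"
  shows "pmf (tri_channel p (map_option Not s)) (map_option Not k) = pmf (tri_channel p s) k"
  using assms by (cases s; cases k) (auto simp: pmf_tri_channel)

lemma sum_map_Not: "(\<Sum>x\<in>UNIV. h (map_option Not x)) = (\<Sum>x\<in>UNIV. h x)"
  for h :: "bool option \<Rightarrow> 'a::comm_monoid_add"
  by (simp add: sum_UNIV_tri ac_simps)

lemma tri_lift_map_Not:
  "tri_lift f (map_option Not a) (map_option Not b) = map_option Not k
    \<longleftrightarrow> tri_lift (\<lambda>x y. \<not> f (\<not> x) (\<not> y)) a b = k"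
  by (cases a; cases b; cases k; cases "the a"; cases "the b") auto

lemma pmf_tri_node_complement:
  assumes "0 \<le> p" "p \<le> 1/2"
  shows "pmf (tri_node (\<lambda>x y. \<not> f (\<not> x) (\<not> y)) p a b) k
       = pmf (tri_node f p (map_option Not a) (map_option Not b)) (map_option Not k)"
  unfolding pmf_tri_node
  by (subst (2) sum_map_Not[symmetric], subst (3) sum_map_Not[symmetric])
     (simp add: pmf_tri_channel_map_Not[OF assms] tri_lift_map_Not)

text \<open>The channel is symmetric under complementing all bits, so only the gate gets
  conjugated.\<close>

lemma potential_complement:
  assumes "0 \<le> p" "p \<le> 1/2" "potential f p \<rho> w g"
  shows "potential (\<lambda>x y. \<not> f (\<not> x) (\<not> y)) p \<rho>
    (\<lambda>a b c. w (map_option Not a) (map_option Not b) (map_option Not c))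
    (\<lambda>a b c. g (map_option Not a) (map_option Not b) (map_option Not c))"
  unfolding potential_def
proof (intro conjI allI)
  let ?m = "map_option Not"
  have pot: "of_bool (b = None) \<le> w a b c" "w (Some x) (Some y) (Some z) = 0" "g (Some x) (Some y) (Some z) = 0"
    "(\<Sum>x\<in>UNIV. \<Sum>y\<in>UNIV. \<Sum>z\<in>UNIV.
        pmf (tri_node f p a b) x * pmf (tri_node f p b c) y * pmf (tri_node f p c d) z * w x y z)
      \<le> \<rho> * w a b c - g a b c + g b c d" for a b c d x y z
    using assms(3) by (auto simp: potential_def)
  fix a b c d
  show "of_bool (b = None) \<le> w (?m a) (?m b) (?m c)"
    using pot(1)[of "?m b" "?m a" "?m c"] by simp
  have "(\<Sum>x\<in>UNIV. \<Sum>y\<in>UNIV. \<Sum>z\<in>UNIV. pmf (tri_node (\<lambda>x y. \<not> f (\<not> x) (\<not> y)) p a b) x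
        * pmf (tri_node (\<lambda>x y. \<not> f (\<not> x) (\<not> y)) p b c) y
        * pmf (tri_node (\<lambda>x y. \<not> f (\<not> x) (\<not> y)) p c d) z * w (?m x) (?m y) (?m z))
      = (\<Sum>x\<in>UNIV. \<Sum>y\<in>UNIV. \<Sum>z\<in>UNIV. pmf (tri_node f p (?m a) (?m b)) x
        * pmf (tri_node f p (?m b) (?m c)) y * pmf (tri_node f p (?m c) (?m d)) z * w x y z)"
    by (simp add: pmf_tri_node_complement[OF assms(1,2)] sum_UNIV_tri ac_simps)
  also have "\<dots> \<le> \<rho> * w (?m a) (?m b) (?m c) - g (?m a) (?m b) (?m c) + g (?m b) (?m c) (?m d)"
    by (rule pot)
  finally show "(\<Sum>x\<in>UNIV. \<Sum>y\<in>UNIV. \<Sum>z\<in>UNIV. pmf (tri_node (\<lambda>x y. \<not> f (\<not> x) (\<not> y)) p a b) x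
        * pmf (tri_node (\<lambda>x y. \<not> f (\<not> x) (\<not> y)) p b c) y
        * pmf (tri_node (\<lambda>x y. \<not> f (\<not> x) (\<not> y)) p c d) z * w (?m x) (?m y) (?m z))
      \<le> \<rho> * w (?m a) (?m b) (?m c) - g (?m a) (?m b) (?m c) + g (?m b) (?m c) (?m d)" .
qed (use assms(3) in \<open>auto simp: potential_def\<close>)

lemma tri_lift_swap: "tri_lift (\<lambda>x y. f y x) a b = tri_lift f b a"
  by (cases a; cases b) auto

lemma pmf_tri_node_swap: "pmf (tri_node (\<lambda>x y. f y x) p a b) k = pmf (tri_node f p b a) k"
  unfolding pmf_tri_node tri_lift_swap[of f] by (subst sum.swap) (simp only: mult.commute[of "pmf (tri_channel p a) _"])

text \<open>Reflection moves the charge \<open>\<rho> * w\<close> from the first three of the four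
  sites to the last three. The summand \<open>\<rho> * w c b a\<close> in the new correction
  telescopes it back.\<close>

lemma potential_swap:
  assumes "potential f p \<rho> w g"
  shows "potential (\<lambda>x y. f y x) p \<rho> (\<lambda>a b c. w c b a) (\<lambda>a b c. \<rho> * w c b a - g c b a)"
  unfolding potential_def
proof (intro conjI allI)
  fix a b c d
  have "(\<Sum>x\<in>UNIV. \<Sum>y\<in>UNIV. \<Sum>z\<in>UNIV. pmf (tri_node f p b a) x * pmf (tri_node f p c b) y
        * pmf (tri_node f p d c) z * w z y x)
      = (\<Sum>z\<in>UNIV. \<Sum>y\<in>UNIV. \<Sum>x\<in>UNIV. pmf (tri_node f p d c) z * pmf (tri_node f p c b) y
        * pmf (tri_node f p b a) x * w z y x)"
    by (simp add: sum_UNIV_tri ac_simps)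
  also have "\<dots> \<le> \<rho> * w d c b - g d c b + g c b a"
    using assms by (auto simp: potential_def)
  finally show "(\<Sum>x\<in>UNIV. \<Sum>y\<in>UNIV. \<Sum>z\<in>UNIV. pmf (tri_node (\<lambda>x y. f y x) p a b) x
        * pmf (tri_node (\<lambda>x y. f y x) p b c) y * pmf (tri_node (\<lambda>x y. f y x) p c d) z * w z y x)
      \<le> \<rho> * w c b a - (\<rho> * w c b a - g c b a) + (\<rho> * w d c b - g d c b)"
    by (simp add: pmf_tri_node_swap[of f])
qed (use assms in \<open>auto simp: potential_def\<close>)

text \<open>An undetermined output requires an undetermined message on the first edge. The first
  parent of the middle site is again the middle site \<open>b\<close>, so the correction can be
  0.\<close>

lemma potential_first_argument:
  assumes "0 \<le> p" "p \<le> 1/2"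
  shows "potential (\<lambda>x y. h x) p (1 - 2 * p) (\<lambda>a b c. of_bool (b = None)) (\<lambda>a b c. 0)"
  unfolding potential_def
proof (intro conjI allI)
  fix a b c d
  let ?q = "\<lambda>a b. pmf (tri_node (\<lambda>x y. h x) p a b)"
  have lift: "tri_lift (\<lambda>x y. h x) x y = None \<Longrightarrow> x = None" for x y
    by (cases x; cases y) auto
  have "?q b c None \<le> (\<Sum>x\<in>UNIV. \<Sum>y\<in>UNIV. pmf (tri_channel p b) x * pmf (tri_channel p c) y * of_bool (x = None))"
    unfolding pmf_tri_node by (intro sum_mono mult_left_mono mult_nonneg_nonneg) (auto dest: lift)
  also have "\<dots> = (\<Sum>x\<in>UNIV. pmf (tri_channel p b) x * of_bool (x = None) * (\<Sum>y\<in>UNIV. pmf (tri_channel p c) y))"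
    unfolding sum_distrib_left by (simp add: mult_ac)
  also have "\<dots> = (1 - 2 * p) * of_bool (b = None)"
    unfolding sum_pmf_UNIV using assms by (simp add: sum_UNIV_tri pmf_tri_channel split: option.split)
  finally have "?q b c None \<le> (1 - 2 * p) * of_bool (b = None)" .
  moreover have "(\<Sum>x\<in>UNIV. \<Sum>y\<in>UNIV. \<Sum>z\<in>UNIV. ?q a b x * ?q b c y * ?q c d z * of_bool (y = None))
      = (\<Sum>x\<in>UNIV. ?q a b x) * (\<Sum>y\<in>UNIV. ?q b c y * of_bool (y = None)) * (\<Sum>z\<in>UNIV. ?q c d z)"
    by (simp add: sum_UNIV_tri algebra_simps)
  then have "(\<Sum>x\<in>UNIV. \<Sum>y\<in>UNIV. \<Sum>z\<in>UNIV. ?q a b x * ?q b c y * ?q c d z * of_bool (y = None)) = ?q b c None"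
    unfolding sum_pmf_UNIV by (simp add: sum_UNIV_tri)
  ultimately show "(\<Sum>x\<in>UNIV. \<Sum>y\<in>UNIV. \<Sum>z\<in>UNIV. ?q a b x * ?q b c y * ?q c d z * of_bool (y = None))
      \<le> (1 - 2 * p) * of_bool (b = None) - 0 + 0" by simp
qed auto

section \<open>Potentials for the NAND and AND-NOT gates\<close>

text \<open>Probabilities that the channel delivers the determined bit \<^const>\<open>True\<close> resp. \<^const>\<open>False\<close>.\<close>

definition recv_True :: "real \<Rightarrow> bool option \<Rightarrow> real" where
  "recv_True p s = (if s = Some True then 1 - p else p)"

definition recv_False :: "real \<Rightarrow> bool option \<Rightarrow> real" where
  "recv_False p s = (if s = Some False then 1 - p else p)"

text \<open>The output is \<open>True\<close> once either edge delivers a determined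
  \<open>False\<close>, and \<open>False\<close> when both deliver a determined \<open>True\<close>;
  otherwise it is undetermined.\<close>

lemma pmf_tri_node_nand:
  assumes "0 \<le> p" "p \<le> 1/2"
  shows "pmf (tri_node (\<lambda>x y. x \<longrightarrow> \<not> y) p a b) (Some True) = 1 - (1 - recv_False p a) * (1 - recv_False p b)"
    and "pmf (tri_node (\<lambda>x y. x \<longrightarrow> \<not> y) p a b) (Some False) = recv_True p a * recv_True p b"
    and "pmf (tri_node (\<lambda>x y. x \<longrightarrow> \<not> y) p a b) None
      = (1 - recv_False p a) * (1 - recv_False p b) - recv_True p a * recv_True p b"
  using assms
  by (cases a; cases b; cases "the a"; cases "the b";
      simp add: pmf_tri_node sum_UNIV_tri pmf_tri_channel recv_True_def recv_False_def algebra_simps)+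

lemma pmf_tri_node_and_not:
  assumes "0 \<le> p" "p \<le> 1/2"
  shows "pmf (tri_node (\<lambda>x y. x \<and> \<not> y) p a b) (Some True) = recv_True p a * recv_False p b"
    and "pmf (tri_node (\<lambda>x y. x \<and> \<not> y) p a b) (Some False) = 1 - (1 - recv_False p a) * (1 - recv_True p b)"
    and "pmf (tri_node (\<lambda>x y. x \<and> \<not> y) p a b) None
      = (1 - recv_False p a) * (1 - recv_True p b) - recv_True p a * recv_False p b"
  using assms
  by (cases a; cases b; cases "the a"; cases "the b";
      simp add: pmf_tri_node sum_UNIV_tri pmf_tri_channel recv_True_def recv_False_def algebra_simps)+

text \<open>These bounds let \<open>linarith\<close> treat the powers of \<open>p\<close> as
  separate variables. Degree 7 occurs for NAND: six channel uses times a weight linear in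
  \<open>p\<close>.\<close>

lemma monomial_bounds:
  fixes p :: real
  assumes "0 \<le> p" "p \<le> 1/16"
  shows "0 \<le> p * p" "p * p \<le> p / 16"
    "0 \<le> p * (p * p)" "p * (p * p) \<le> p * p / 16"
    "0 \<le> p * (p * (p * p))" "p * (p * (p * p)) \<le> p * (p * p) / 16"
    "0 \<le> p * (p * (p * (p * p)))" "p * (p * (p * (p * p))) \<le> p * (p * (p * p)) / 16"
    "0 \<le> p * (p * (p * (p * (p * p))))" "p * (p * (p * (p * (p * p)))) \<le> p * (p * (p * (p * p))) / 16"
    "0 \<le> p * (p * (p * (p * (p * (p * p)))))"
    "p * (p * (p * (p * (p * (p * p))))) \<le> p * (p * (p * (p * (p * p)))) / 16"
proof -
  have step: "0 \<le> p * x" "p * x \<le> x / 16" if "0 \<le> x" for x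
    using assms that mult_right_mono[of p "1/16" x] by auto
  show "0 \<le> p * p" "p * p \<le> p / 16"
    "0 \<le> p * (p * p)" "p * (p * p) \<le> p * p / 16"
    "0 \<le> p * (p * (p * p))" "p * (p * (p * p)) \<le> p * (p * p) / 16"
    "0 \<le> p * (p * (p * (p * p)))" "p * (p * (p * (p * p))) \<le> p * (p * (p * p)) / 16"
    "0 \<le> p * (p * (p * (p * (p * p))))" "p * (p * (p * (p * (p * p)))) \<le> p * (p * (p * (p * p))) / 16"
    "0 \<le> p * (p * (p * (p * (p * (p * p)))))"
    "p * (p * (p * (p * (p * (p * p))))) \<le> p * (p * (p * (p * (p * p)))) / 16"
    by (intro step assms(1))+
qed

text \<open>At \<open>p = 0\<close> an undetermined site turns a determined \<^const>\<open>True\<close> on its left undetermined one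
  step later; the second summand counts these in advance.\<close>

definition and_not_weight :: "bool option \<Rightarrow> bool option \<Rightarrow> bool option \<Rightarrow> real" where
  "and_not_weight a b c = of_bool (b = None) + of_bool (a = Some True \<and> b = None)"

text \<open>At \<open>p = 0\<close> the inequality of \<open>potential\<close> on \<open>a\<close>,
  \<open>b\<close>, \<open>c\<close>, \<open>d\<close> is an equality, except for slack 1 when
  \<open>a\<close> is undetermined and \<open>b\<close> is \<open>True\<close>. The terms of order
  \<open>p\<close> make room for the factor \<open>1 - p / 4\<close>.\<close>

fun and_not_corr :: "real \<Rightarrow> bool option \<Rightarrow> bool option \<Rightarrow> bool option \<Rightarrow> real" where
  "and_not_corr p (Some False) None c = 9 / 4 * p"
| "and_not_corr p (Some True) None c = 1 - 7 / 4 * p"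
| "and_not_corr p None (Some False) c = - 1 / 4 * p"
| "and_not_corr p None (Some True) c = - 1 + 15 / 4 * p"
| "and_not_corr p None None c = 3 / 4 * p"
| "and_not_corr p (Some _) (Some _) c = 0"

text \<open>A finite check over the 81 patterns of four sites, each a polynomial inequality in
  \<open>p\<close>.\<close>

lemma potential_and_not:
  assumes "0 \<le> p" "p \<le> 1/16"
  shows "potential (\<lambda>x y. x \<and> \<not> y) p (1 - p / 4) and_not_weight (and_not_corr p)"
proof -
  have p: "0 \<le> p" "p \<le> 1/2" using assms by auto
  have "\<forall>a b c d. (\<Sum>x\<in>UNIV. \<Sum>y\<in>UNIV. \<Sum>z\<in>UNIV. pmf (tri_node (\<lambda>x y. x \<and> \<not> y) p a b) x
        * pmf (tri_node (\<lambda>x y. x \<and> \<not> y) p b c) y * pmf (tri_node (\<lambda>x y. x \<and> \<not> y) p c d) z * and_not_weight x y z)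
      \<le> (1 - p / 4) * and_not_weight a b c - and_not_corr p a b c + and_not_corr p b c d"
    unfolding forall_tri
    apply (intro conjI)
    apply (simp_all add: sum_UNIV_tri pmf_tri_node_and_not[OF p] and_not_weight_def)
    apply (simp_all add: recv_True_def recv_False_def algebra_simps)
    using assms monomial_bounds[OF assms] apply linarith+
    done
  then show ?thesis
    unfolding potential_def by (auto simp: and_not_weight_def)
qed

text \<open>Write \<open>u\<close> for an undetermined site. At \<open>p = 0\<close> the quantity
  \<open>2 #u + #1u + #u1 + #01u + #u10\<close> changes by \<open>- 2 #0u0\<close> in each step. The terms of order \<open>p\<close> make
  the first-order drift nonpositive, and all-undetermined rows lose weight at order \<open>p\<^sup>2\<close>.
  These terms and the correction \<open>nand_corr\<close>, a longest-path potential on the graph of windows, come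
  from solving the resulting linear program.\<close>

definition nand_weight :: "real \<Rightarrow> bool option \<Rightarrow> bool option \<Rightarrow> bool option \<Rightarrow> real" where
  "nand_weight p a b c = 2 * of_bool (b = None)
     + (1 + 2 * p) * (of_bool (a = Some True \<and> b = None) + of_bool (b = None \<and> c = Some True))
     + of_bool (a = Some False \<and> b = Some True \<and> c = None) + of_bool (a = None \<and> b = Some True \<and> c = Some False)
     + 2 * p * (of_bool (a = Some True \<and> b = Some False \<and> c = None) + of_bool (a = None \<and> b = Some False \<and> c = Some True))"

fun nand_corr :: "real \<Rightarrow> bool option \<Rightarrow> bool option \<Rightarrow> bool option \<Rightarrow> real" where
  "nand_corr p (Some False) (Some False) None = 2 * p\<^sup>2"
| "nand_corr p (Some False) (Some True) None = p - 2 * p\<^sup>2"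
| "nand_corr p (Some False) None (Some False) = 4 * p - 2 * p\<^sup>2"
| "nand_corr p (Some False) None (Some True) = 3 * p + 2 * p\<^sup>2"
| "nand_corr p (Some False) None None = 3 * p + 2 * p\<^sup>2"
| "nand_corr p (Some True) (Some False) None = p - 4 * p\<^sup>2"
| "nand_corr p (Some True) (Some True) None = 2 * p - 6 * p\<^sup>2"
| "nand_corr p (Some True) None (Some False) = 3 - 4 * p - 4 * p\<^sup>2"
| "nand_corr p (Some True) None (Some True) = 2 + 2 * p - 18 * p\<^sup>2"
| "nand_corr p (Some True) None None = 2 + 2 * p - 16 * p\<^sup>2"
| "nand_corr p None (Some False) (Some False) = - 2 * p\<^sup>2"
| "nand_corr p None (Some False) (Some True) = p - 8 * p\<^sup>2"
| "nand_corr p None (Some False) None = - 3 * p\<^sup>2"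
| "nand_corr p None (Some True) (Some False) = 1 - 8 * p + 23 / 4 * p\<^sup>2"
| "nand_corr p None (Some True) (Some True) = - 2 * p - 33 / 4 * p\<^sup>2"
| "nand_corr p None (Some True) None = - 4 * p + 11 / 4 * p\<^sup>2"
| "nand_corr p None None (Some False) = 2 - 3 * p - 5 / 2 * p\<^sup>2"
| "nand_corr p None None (Some True) = 1 + p\<^sup>2"
| "nand_corr p None None None = 1 - 1 / 2 * p\<^sup>2"
| "nand_corr p (Some _) (Some _) (Some _) = 0"


lemma potential_nand:
  assumes "0 \<le> p" "p \<le> 1/16"
  shows "potential (\<lambda>x y. x \<longrightarrow> \<not> y) p (1 - p\<^sup>2 / 4) (nand_weight p) (nand_corr p)"
proof -
  have p: "0 \<le> p" "p \<le> 1/2" using assms by auto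
  have "\<forall>a b c d. (\<Sum>x\<in>UNIV. \<Sum>y\<in>UNIV. \<Sum>z\<in>UNIV. pmf (tri_node (\<lambda>x y. x \<longrightarrow> \<not> y) p a b) x
        * pmf (tri_node (\<lambda>x y. x \<longrightarrow> \<not> y) p b c) y * pmf (tri_node (\<lambda>x y. x \<longrightarrow> \<not> y) p c d) z * nand_weight p x y z)
      \<le> (1 - p\<^sup>2 / 4) * nand_weight p a b c - nand_corr p a b c + nand_corr p b c d"
    unfolding forall_tri
    apply (intro conjI)
    apply (simp_all add: sum_UNIV_tri pmf_tri_node_nand[OF p] nand_weight_def)
    apply (simp_all add: recv_True_def recv_False_def algebra_simps power2_eq_square)
    using assms monomial_bounds[OF assms] apply linarith+
    done
  then show ?thesis
    unfolding potential_def using assms by (auto simp: nand_weight_def)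
qed

section \<open>The XOR gate\<close>

definition toggle :: "'a set \<Rightarrow> ('a \<Rightarrow> bool) \<Rightarrow> 'a \<Rightarrow> bool" where
  "toggle S z e = (z e \<noteq> (e \<in> S))"

lemma expectation_Pi_pmf_insert_bernoulli:
  fixes h :: "('a \<Rightarrow> bool) \<Rightarrow> real"
  assumes "finite A" "x \<notin> A" "0 \<le> p" "p \<le> 1"
  shows "measure_pmf.expectation (Pi_pmf (insert x A) False (\<lambda>_. bernoulli_pmf p)) h
       = measure_pmf.expectation (Pi_pmf A False (\<lambda>_. bernoulli_pmf p))
           (\<lambda>z. p * h (z(x := True)) + (1 - p) * h (z(x := False)))"
proof -
  have "Pi_pmf (insert x A) False (\<lambda>_. bernoulli_pmf p)
      = bind_pmf (Pi_pmf A False (\<lambda>_. bernoulli_pmf p)) (\<lambda>z. map_pmf (\<lambda>y. z(x := y)) (bernoulli_pmf p))"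
    unfolding Pi_pmf_insert'[OF assms(1,2)] map_pmf_def by (rule bind_commute_pmf)
  then show ?thesis
    using assms by (simp add: expectation_bind_pmf_finite finite_set_Pi_pmf mult.commute)
qed

text \<open>Integrating out one pair of coordinates contracts by \<open>(1 - p)\<^sup>2 - p\<^sup>2 + 2 p (1 - p)\<close>,
  because the values of \<open>\<sigma>\<close> at equal bits cancel partially.\<close>

lemma antisymmetric_expectation_le:
  fixes \<sigma> :: "('a \<Rightarrow> bool) \<Rightarrow> real"
  assumes "finite F" "finite E" "0 \<le> p" "p \<le> 1/2"
    and "\<And>k. k \<in> F \<Longrightarrow> a k \<in> E \<and> b k \<in> E \<and> a k \<noteq> b k"
    and "\<And>k l. k \<in> F \<Longrightarrow> l \<in> F \<Longrightarrow> k \<noteq> l \<Longrightarrow> {a k, b k} \<inter> {a l, b l} = {}"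
    and "\<And>k z. k \<in> F \<Longrightarrow> \<sigma> (toggle {a k, b k} z) = - \<sigma> z"
    and "\<And>z. \<bar>\<sigma> z\<bar> \<le> M"
  shows "\<bar>measure_pmf.expectation (Pi_pmf E False (\<lambda>_. bernoulli_pmf p)) \<sigma>\<bar> \<le> M * (1 - 2 * p\<^sup>2) ^ card F"
  using assms(1,2,5-)
proof (induction F arbitrary: E \<sigma> M rule: finite_induct)
  case empty
  have "\<bar>measure_pmf.expectation (Pi_pmf E False (\<lambda>_. bernoulli_pmf p)) \<sigma>\<bar>
      \<le> measure_pmf.expectation (Pi_pmf E False (\<lambda>_. bernoulli_pmf p)) (\<lambda>z. \<bar>\<sigma> z\<bar>)"
    by (rule integral_abs_bound)
  also have "\<dots> \<le> measure_pmf.expectation (Pi_pmf E False (\<lambda>_. bernoulli_pmf p)) (\<lambda>z. M)"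
    using empty.prems(1,5)
    by (intro integral_mono integrable_measure_pmf_finite finite_set_Pi_pmf) auto
  finally show ?case by simp
next
  case (insert k F)
  define E' where "E' = E - {a k, b k}"
  \<comment> \<open>The conditional expectation of \<open>\<sigma>\<close> once the coordinates
    \<open>a k\<close> and \<open>b k\<close> are integrated out.\<close>
  define \<sigma>' where "\<sigma>' z = p * (p * \<sigma> (z(a k := True, b k := True)) + (1 - p) * \<sigma> (z(a k := True, b k := False)))
    + (1 - p) * (p * \<sigma> (z(a k := False, b k := True)) + (1 - p) * \<sigma> (z(a k := False, b k := False)))" for z
  have E: "E = insert (b k) (insert (a k) E')" "b k \<notin> insert (a k) E'" "a k \<notin> E'" "finite E'"
    using insert.prems(1) insert.prems(2)[of k] by (auto simp: E'_def)
  have "measure_pmf.expectation (Pi_pmf E False (\<lambda>_. bernoulli_pmf p)) \<sigma>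
      = measure_pmf.expectation (Pi_pmf E' False (\<lambda>_. bernoulli_pmf p)) \<sigma>'"
    unfolding E(1) \<sigma>'_def using E(2-) assms(3,4)
    by (simp add: expectation_Pi_pmf_insert_bernoulli)
  also have "\<bar>\<dots>\<bar> \<le> (M * (1 - 2 * p\<^sup>2)) * (1 - 2 * p\<^sup>2) ^ card F"
  proof (rule insert.IH)
    show "finite E'" by fact
    show "a l \<in> E' \<and> b l \<in> E' \<and> a l \<noteq> b l" if "l \<in> F" for l
    proof -
      have "l \<noteq> k" using that insert.hyps(2) by auto
      then show ?thesis
        using that insert.prems(2)[of l] insert.prems(3)[of l k] by (auto simp: E'_def)
    qed
    show "{a l, b l} \<inter> {a m, b m} = {}" if "l \<in> F" "m \<in> F" "l \<noteq> m" for l m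
      using that by (intro insert.prems(3)) auto
    show "\<sigma>' (toggle {a l, b l} z) = - \<sigma>' z" if l: "l \<in> F" for l z
    proof -
      \<comment> \<open>Fixing pair \<open>k\<close> commutes with toggling the disjoint pair
        \<open>l\<close>, so \<open>\<sigma>'\<close> inherits the antisymmetry.\<close>
      have "{a l, b l} \<inter> {a k, b k} = {}"
        using l insert.hyps(2) by (intro insert.prems(3)) auto
      then have "(toggle {a l, b l} z)(a k := x, b k := y) = toggle {a l, b l} (z(a k := x, b k := y))" for x y
        by (auto simp: fun_eq_iff toggle_def)
      then show ?thesis
        using insert.prems(4)[of l] l by (simp add: \<sigma>'_def algebra_simps)
    qed
    show "\<bar>\<sigma>' z\<bar> \<le> M * (1 - 2 * p\<^sup>2)" for z
    proof -
      have "z(a k := True, b k := True) = toggle {a k, b k} (z(a k := False, b k := False))"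
        by (auto simp: fun_eq_iff toggle_def)
      then have "\<sigma> (z(a k := True, b k := True)) = - \<sigma> (z(a k := False, b k := False))"
        using insert.prems(4)[of k] by simp
      \<comment> \<open>The equal-bit weights combine to
        \<open>(1 - p)\<^sup>2 - p\<^sup>2 = 1 - 2 * p\<close>; below, the two mixed values are
        bounded by \<open>M\<close> each.\<close>
      then have "\<sigma>' z = (1 - 2 * p) * \<sigma> (z(a k := False, b k := False))
          + p * (1 - p) * (\<sigma> (z(a k := True, b k := False)) + \<sigma> (z(a k := False, b k := True)))"
        by (simp add: \<sigma>'_def algebra_simps power2_eq_square)
      also have "\<bar>\<dots>\<bar> \<le> (1 - 2 * p) * M + p * (1 - p) * (M + M)"
      proof (intro order_trans[OF abs_triangle_ineq] add_mono)
        show "\<bar>(1 - 2 * p) * \<sigma> (z(a k := False, b k := False))\<bar> \<le> (1 - 2 * p) * M"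
          using assms(3,4) insert.prems(5) by (auto simp: abs_mult intro!: mult_left_mono)
        have "\<bar>x + y\<bar> \<le> M + M" if "\<bar>x\<bar> \<le> M" "\<bar>y\<bar> \<le> M" for x y :: real
          using that by linarith
        then show "\<bar>p * (1 - p) * (\<sigma> (z(a k := True, b k := False)) + \<sigma> (z(a k := False, b k := True)))\<bar>
            \<le> p * (1 - p) * (M + M)"
          unfolding abs_mult using assms(3,4) insert.prems(5)
          by (intro mult_mono) (auto intro: mult_nonneg_nonneg)
      qed
      also have "\<dots> = M * (1 - 2 * p\<^sup>2)"
        by (simp add: algebra_simps power2_eq_square)
      finally show ?thesis .
    qed
  qed
  finally show ?case using insert.hyps by (simp add: mult.assoc)
qed

section \<open>Pascal's triangle modulo 2 and the noise pairs that imitate the origin\<close>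

text \<open>\<open>2 ^ k\<close> divides \<open>i\<close> times the binomial coefficient. An odd
  coefficient is coprime to \<open>2 ^ k\<close>, so \<open>2 ^ k\<close> would divide the smaller
  number \<open>i\<close>.\<close>

lemma even_binomial_power2:
  assumes "0 < i" "i < 2 ^ k"
  shows "even ((2::nat) ^ k choose i)"
proof (rule ccontr)
  assume odd: "odd ((2::nat) ^ k choose i)"
  obtain j where j: "i = Suc j" using assms(1) by (cases i) auto
  obtain m where m: "(2::nat) ^ k = Suc m" by (cases "(2::nat) ^ k") auto
  have "(2::nat) ^ k dvd i * (2 ^ k choose i)"
    unfolding j m Suc_times_binomial by (rule dvd_triv_left)
  moreover have "coprime ((2::nat) ^ k) (2 ^ k choose i)"
    using odd by simp
  ultimately have "(2::nat) ^ k dvd i" by (simp add: coprime_dvd_mult_left_iff)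
  with assms show False by (auto dest: dvd_imp_le)
qed

definition dyadic_edges :: "nat \<Rightarrow> (node \<times> node) set" where
  "dyadic_edges k = {((2 ^ k - 1, 0), (2 ^ k, 0)), ((2 ^ k - 1, 2 ^ k - 1), (2 ^ k, 2 ^ k))}"

context
  fixes f :: "bool \<Rightarrow> bool \<Rightarrow> bool"
  assumes f_Not: "\<And>x y. f (\<not> x) y = (\<not> f x y)" "\<And>x y. f x (\<not> y) = (\<not> f x y)"
begin

text \<open>By \<open>f_Not\<close> the gate is XOR or XNOR, so flips add modulo 2 whatever the
  noise, and they spread by Pascal's recursion.\<close>

lemma eta_Not: "eta f z (\<not> b) s i = (eta f z b s i \<noteq> odd (s choose i))"
proof (induction s arbitrary: i)
  case 0
  show ?case by (cases i) auto
next
  case (Suc s)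
  have bsc: "bsc z (x \<noteq> P) = (bsc z x \<noteq> P)" for z x P
    by (auto simp: bsc_def)
  have f: "f (x \<noteq> P) (y \<noteq> Q) = (f x y \<noteq> (P \<noteq> Q))" for x y P Q
    using f_Not by (cases P; cases Q) auto
  consider "i = 0" | "0 < i" "i < Suc s" | "i = Suc s" | "Suc s < i" by linarith
  then show ?case
  proof cases
    case 1
    then show ?thesis using Suc[of 0] by (auto simp: bsc_def)
  next
    case 2
    obtain j where j: "i = Suc j" using 2 by (cases i) auto
    have "eta f z (\<not> b) (Suc s) i = f (bsc (z ((s, j), (Suc s, i))) (eta f z (\<not> b) s j))
        (bsc (z ((s, i), (Suc s, i))) (eta f z (\<not> b) s i))"
      using 2 by (simp add: j)
    also have "\<dots> = (eta f z b (Suc s) i \<noteq> (odd (s choose j) \<noteq> odd (s choose i)))"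
      unfolding Suc bsc f using 2 by (simp add: j)
    also have "(odd (s choose j) \<noteq> odd (s choose i)) = odd (Suc s choose i)"
      by (simp add: j)
    finally show ?thesis .
  next
    case 3
    then show ?thesis using Suc[of s] by (auto simp: bsc_def)
  next
    case 4
    then show ?thesis by (simp add: binomial_eq_0)
  qed
qed

lemma eta_toggle_below: "s < 2 ^ k \<Longrightarrow> eta f (toggle (dyadic_edges k) z) b s = eta f z b s"
  by (intro eta_cong) (auto simp: toggle_def dyadic_edges_def grid_edges_def)

text \<open>In row \<open>2 ^ k\<close> a flip of the origin is visible only at the two ends, which
  is what the toggled edges produce. Later rows see unchanged noise, so the agreement
  persists.\<close>

lemma eta_toggle: "2 ^ k \<le> s \<Longrightarrow> eta f (toggle (dyadic_edges k) z) b s = eta f z (\<not> b) s"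
proof (induction s rule: nat_induct_at_least)
  case base
  obtain m where m: "(2::nat) ^ k = Suc m" by (cases "(2::nat) ^ k") auto
  have below: "eta f (toggle (dyadic_edges k) z) b m = eta f z b m"
    by (rule eta_toggle_below) (simp add: m)
  have edge: "toggle (dyadic_edges k) z ((m, i), (Suc m, j))
      = (z ((m, i), (Suc m, j)) \<noteq> (i = 0 \<and> j = 0 \<or> i = m \<and> j = Suc m))" for i j
    by (simp add: toggle_def dyadic_edges_def m)
  have binom: "odd (Suc m choose i) \<longleftrightarrow> i = 0 \<or> i = Suc m" for i
    using even_binomial_power2[of i k] by (cases "i = 0"; cases "i = Suc m"; cases "i \<le> Suc m") (auto simp: m binomial_eq_0)
  show ?case
    unfolding m
  proof
    fix i
    have "eta f (toggle (dyadic_edges k) z) b (Suc m) i = (eta f z b (Suc m) i \<noteq> (i = 0 \<or> i = Suc m))"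
      by (auto simp: below edge bsc_def)
    then show "eta f (toggle (dyadic_edges k) z) b (Suc m) i = eta f z (\<not> b) (Suc m) i"
      unfolding eta_Not binom .
  qed
next
  case (Suc s)
  have "toggle (dyadic_edges k) z ((s, i), (Suc s, j)) = z ((s, i), (Suc s, j))" for i j
    using Suc.hyps by (auto simp: toggle_def dyadic_edges_def)
  then show ?case using Suc.IH by (simp add: fun_eq_iff)
qed

text \<open>\<open>\<sigma>\<close> compares the two origin bits under the same noise. Toggling the
  pair \<open>k\<close> exchanges them and negates \<open>\<sigma>\<close>; the \<open>n\<close>
  pairs with \<open>k < n\<close> all lie within the first \<open>t\<close> levels.\<close>

lemma tv_dist_le_if_antisymmetric:
  assumes "0 \<le> p" "p \<le> 1/2" "2 ^ n \<le> t"
  shows "tv_dist (eta_law f p True t) (eta_law f p False t) \<le> (1 - 2 * p\<^sup>2) ^ n"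
proof (rule tv_dist_le)
  fix A
  define \<sigma> where "\<sigma> z = indicat_real A (eta f z True t) - indicat_real A (eta f z False t)" for z
  have prob: "measure_pmf.prob (eta_law f p b t) A
      = measure_pmf.expectation (edge_noise p t) (\<lambda>z. indicat_real A (eta f z b t))" for b
  proof -
    have "measure_pmf.prob (eta_law f p b t) A = measure_pmf.expectation (eta_law f p b t) (indicat_real A)"
      by simp
    then show ?thesis by (simp only: eta_law_def integral_map_pmf)
  qed
  have le: "2 ^ k \<le> t" if "k < n" for k
    using that assms(3) by (intro order_trans[OF power_increasing[of k n "2::nat"]]) auto
  let ?a = "\<lambda>k. ((2 ^ k - 1, 0), (2 ^ k, 0)) :: node \<times> node"
    and ?b = "\<lambda>k. ((2 ^ k - 1, 2 ^ k - 1), (2 ^ k, 2 ^ k)) :: node \<times> node"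
  have "\<bar>measure_pmf.expectation (edge_noise p t) \<sigma>\<bar> \<le> 1 * (1 - 2 * p\<^sup>2) ^ card {..<n}"
    unfolding edge_noise_def
  proof (rule antisymmetric_expectation_le[where a = ?a and b = ?b])
    fix k assume k: "k \<in> {..<n}"
    then have "2 ^ k \<le> t" using le by simp
    moreover have "\<exists>m. (2::nat) ^ k = Suc m" by (cases "(2::nat) ^ k") auto
    ultimately show "?a k \<in> grid_edges t \<and> ?b k \<in> grid_edges t \<and> ?a k \<noteq> ?b k"
      by (auto simp: grid_edges_def)
    show "\<sigma> (toggle {?a k, ?b k} z) = - \<sigma> z" for z
      using eta_toggle[OF \<open>2 ^ k \<le> t\<close>] by (simp add: \<sigma>_def dyadic_edges_def)
  next
    show "{?a k, ?b k} \<inter> {?a l, ?b l} = {}" if "k \<noteq> l" for k l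
      using that by auto
  qed (use assms in \<open>auto simp: \<sigma>_def indicator_def\<close>)
  moreover have "measure_pmf.expectation (edge_noise p t) \<sigma>
      = measure_pmf.prob (eta_law f p True t) A - measure_pmf.prob (eta_law f p False t) A"
    unfolding prob \<sigma>_def edge_noise_def
    by (intro Bochner_Integration.integral_diff integrable_measure_pmf_finite finite_set_Pi_pmf) auto
  ultimately show "\<bar>measure_pmf.prob (eta_law f p True t) A - measure_pmf.prob (eta_law f p False t) A\<bar>
      \<le> (1 - 2 * p\<^sup>2) ^ n" by simp
qed

lemma tv_tendsto_0_if_antisymmetric:
  assumes "0 < p" "p \<le> 1/2"
  shows "(\<lambda>t. tv_dist (eta_law f p True t) (eta_law f p False t)) \<longlonglongrightarrow> 0"
proof (rule LIMSEQ_I)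
  fix \<epsilon> :: real assume "0 < \<epsilon>"
  have "p\<^sup>2 \<le> (1/2)\<^sup>2" using assms by (intro power_mono) auto
  then have "0 \<le> 1 - 2 * p\<^sup>2" "1 - 2 * p\<^sup>2 < 1" using assms by (auto simp: power2_eq_square)
  then obtain n where n: "(1 - 2 * p\<^sup>2) ^ n < \<epsilon>"
    using real_arch_pow_inv[OF \<open>0 < \<epsilon>\<close>] by blast
  show "\<exists>no. \<forall>t\<ge>no. norm (tv_dist (eta_law f p True t) (eta_law f p False t) - 0) < \<epsilon>"
  proof (intro exI allI impI)
    fix t :: nat assume "2 ^ n \<le> t"
    then have "tv_dist (eta_law f p True t) (eta_law f p False t) < \<epsilon>"
      using tv_dist_le_if_antisymmetric[of p n t] n assms by simp
    then show "norm (tv_dist (eta_law f p True t) (eta_law f p False t) - 0) < \<epsilon>"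
      using tv_dist_nonneg[of "eta_law f p True t" "eta_law f p False t"] by simp
  qed
qed

end

section \<open>Gates with a dominant input\<close>

lemma prod_of_bool: "finite B \<Longrightarrow> (\<Prod>e\<in>B. of_bool (Q e)) = (of_bool (\<forall>e\<in>B. Q e) :: real)"
  by (induction B rule: finite_induct) auto

lemma expectation_prod_subset_Pi_pmf:
  fixes P :: "'a \<Rightarrow> 'b::finite pmf" and \<phi> :: "'b \<Rightarrow> real"
  assumes "finite S" "A \<subseteq> S" "\<And>v. 0 \<le> \<phi> v"
  shows "measure_pmf.expectation (Pi_pmf S d P) (\<lambda>y. \<Prod>i\<in>A. \<phi> (y i))
       = (\<Prod>i\<in>A. measure_pmf.expectation (P i) \<phi>)"
proof -
  have restrict: "(\<Prod>i\<in>A. h i) = (\<Prod>i\<in>S. if i \<in> A then h i else 1)" for h :: "'a \<Rightarrow> real"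
    using assms(1,2) by (simp add: prod.inter_restrict[symmetric] Int_absorb1)
  have "measure_pmf.expectation (Pi_pmf S d P) (\<lambda>y. \<Prod>i\<in>S. (if i \<in> A then \<phi> (y i) else 1))
      = (\<Prod>i\<in>S. measure_pmf.expectation (P i) (\<lambda>v. if i \<in> A then \<phi> v else 1))"
    using assms(1,3)
    by (intro expectation_prod_Pi_pmf[of S P "\<lambda>i v. if i \<in> A then \<phi> v else 1"] integrable_measure_pmf_finite) auto
  also have "\<dots> = (\<Prod>i\<in>S. if i \<in> A then measure_pmf.expectation (P i) \<phi> else 1)"
    by (intro prod.cong) auto
  finally show ?thesis unfolding restrict .
qed

context
  fixes f :: "bool \<Rightarrow> bool \<Rightarrow> bool" and c :: bool and p :: real
  assumes dominant: "\<And>x y. f x y = c \<longleftrightarrow> x = c \<or> y = c"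
    and p: "0 < p" "p \<le> 1/2"
begin

text \<open>Since \<open>c\<close> dominates, either \<open>Q\<close> holds at the output iff it
  holds for all incoming messages. Both choices accept the fresh bit \<open>\<not> c\<close> and
  reject \<open>c\<close>, hence a common product formula.\<close>

lemma tri_site_dominant:
  assumes "i \<le> Suc t" and Q: "Q = (\<lambda>v. v \<noteq> Some c) \<or> Q = (\<lambda>v. v = Some (\<not> c))"
  shows "measure_pmf.expectation (tri_site f p t s i) (\<lambda>v. of_bool (Q v))
       = (\<Prod>j\<in>parents t i. (1 - 2 * p) * of_bool (Q (s j)) + p)"
proof -
  have f: "f x y = (if x = c \<or> y = c then c else \<not> c)" for x y
    using dominant[of x y] by auto
  have channel: "measure_pmf.expectation (tri_channel p v) (\<lambda>v. of_bool (Q v)) = (1 - 2 * p) * of_bool (Q v) + p" for v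
    using Q p by (cases v; cases c; cases "the v")
      (auto simp: expectation_finite_UNIV sum_UNIV_tri pmf_tri_channel)
  have lift: "Q (tri_lift f x y) \<longleftrightarrow> Q x \<and> Q y" for x y
    using Q by (cases x; cases y; cases c; cases "the x"; cases "the y") (auto simp: f)
  have node: "measure_pmf.expectation (tri_node f p v w) (\<lambda>v. of_bool (Q v))
      = ((1 - 2 * p) * of_bool (Q v) + p) * ((1 - 2 * p) * of_bool (Q w) + p)" for v w
  proof -
    have "measure_pmf.expectation (tri_node f p v w) (\<lambda>v. of_bool (Q v) :: real)
        = measure_pmf.expectation (pair_pmf (tri_channel p v) (tri_channel p w)) (\<lambda>(x, y). of_bool (Q x) * of_bool (Q y) :: real)"
      unfolding tri_node_def integral_map_pmf case_prod_unfold lift of_bool_conj ..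
    also have "\<dots> = measure_pmf.expectation (tri_channel p v) (\<lambda>v. of_bool (Q v))
        * measure_pmf.expectation (tri_channel p w) (\<lambda>v. of_bool (Q v))"
      unfolding expectation_finite_UNIV sum_UNIV_prod sum_product
      by (intro sum.cong refl) (auto simp: pmf_pair)
    finally show ?thesis unfolding channel .
  qed
  show ?thesis
    using assms(1) by (auto simp: tri_site_def parents_def channel node)
qed

text \<open>The probability that \<open>A\<close> contains an undetermined site and no site
  \<open>Some c\<close>. The difference form is used because both terms obey the same expansion over
  edges.\<close>

definition all_gap :: "nat \<Rightarrow> nat set \<Rightarrow> real" where
  "all_gap t A = measure_pmf.expectation (tri_law f p t)
     (\<lambda>s. of_bool (\<forall>i\<in>A. s i \<noteq> Some c) - of_bool (\<forall>i\<in>A. s i = Some (\<not> c)))"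

lemma all_gap_le:
  assumes "finite A" "A \<subseteq> {..t}"
  shows "all_gap t A \<le> (1 - p) ^ t * of_bool (A \<noteq> {})"
  using assms
proof (induction t arbitrary: A)
  case 0
  have "all_gap 0 A \<le> of_bool (A \<noteq> {})"
    by (auto simp: all_gap_def)
  then show ?case by simp
next
  case (Suc t)
  \<comment> \<open>Edges into \<open>A\<close>, as pairs of a position in row \<open>Suc t\<close>
    and a parent in row \<open>t\<close>. In the expansion, \<open>B\<close> collects the edges that
    pass their input on; the others deliver the fresh bit \<open>\<not> c\<close>.\<close>
  define N where "N = Sigma A (parents t)"
  define \<kappa> where "\<kappa> B = (1 - 2 * p) ^ card B * p ^ card (N - B)" for B :: "(nat \<times> nat) set"
  have fin: "finite N" using Suc.prems by (auto simp: N_def parents_def)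
  have row: "measure_pmf.expectation (tri_row f p t s) (\<lambda>s'. of_bool (\<forall>i\<in>A. Q (s' i)))
      = (\<Sum>B\<in>Pow N. \<kappa> B * of_bool (\<forall>j\<in>snd ` B. Q (s j)))"
    if Q: "Q = (\<lambda>v. v \<noteq> Some c) \<or> Q = (\<lambda>v. v = Some (\<not> c))" for s Q
  proof -
    have "measure_pmf.expectation (tri_row f p t s) (\<lambda>s'. of_bool (\<forall>i\<in>A. Q (s' i)) :: real)
        = measure_pmf.expectation (tri_row f p t s) (\<lambda>s'. \<Prod>i\<in>A. of_bool (Q (s' i)))"
      using Suc.prems by (simp add: prod_of_bool)
    also have "\<dots> = (\<Prod>i\<in>A. measure_pmf.expectation (tri_site f p t s i) (\<lambda>v. of_bool (Q v)))"
      unfolding tri_row_def using Suc.prems by (intro expectation_prod_subset_Pi_pmf) auto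
    also have "\<dots> = (\<Prod>i\<in>A. \<Prod>j\<in>parents t i. (1 - 2 * p) * of_bool (Q (s j)) + p)"
      using Suc.prems by (intro prod.cong tri_site_dominant Q) auto
    also have "\<dots> = (\<Prod>e\<in>N. (1 - 2 * p) * of_bool (Q (s (snd e))) + p)"
      unfolding N_def using Suc.prems(1)
      by (subst prod.Sigma) (auto simp: parents_def case_prod_unfold)
    also have "\<dots> = (\<Sum>B\<in>Pow N. (\<Prod>e\<in>B. (1 - 2 * p) * of_bool (Q (s (snd e)))) * (\<Prod>e\<in>N - B. p))"
      by (rule prod_add[OF fin])
    also have "\<dots> = (\<Sum>B\<in>Pow N. \<kappa> B * of_bool (\<forall>j\<in>snd ` B. Q (s j)))"
      using fin by (intro sum.cong refl) (auto simp: \<kappa>_def prod.distrib prod_of_bool finite_subset)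
    finally show ?thesis .
  qed
  have "all_gap (Suc t) A = measure_pmf.expectation (tri_law f p t) (\<lambda>s.
      measure_pmf.expectation (tri_row f p t s) (\<lambda>s'. of_bool (\<forall>i\<in>A. s' i \<noteq> Some c))
      - measure_pmf.expectation (tri_row f p t s) (\<lambda>s'. of_bool (\<forall>i\<in>A. s' i = Some (\<not> c))))"
    unfolding all_gap_def expectation_tri_law_Suc by (simp only: Bochner_Integration.integral_diff integrable_tri_row)
  also have "\<dots> = measure_pmf.expectation (tri_law f p t) (\<lambda>s. \<Sum>B\<in>Pow N. \<kappa> B *
      (of_bool (\<forall>j\<in>snd ` B. s j \<noteq> Some c) - of_bool (\<forall>j\<in>snd ` B. s j = Some (\<not> c))))"
    unfolding row[of "\<lambda>v. v \<noteq> Some c", simplified] row[of "\<lambda>v. v = Some (\<not> c)", simplified]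
    by (simp add: sum_subtractf right_diff_distrib)
  also have "\<dots> = (\<Sum>B\<in>Pow N. \<kappa> B * all_gap t (snd ` B))"
    unfolding all_gap_def
    by (subst Bochner_Integration.integral_sum) (simp_all add: integrable_tri_law)
  also have "\<dots> \<le> (\<Sum>B\<in>Pow N. \<kappa> B * ((1 - p) ^ t * of_bool (A \<noteq> {})))"
  proof (intro sum_mono mult_left_mono)
    fix B assume B: "B \<in> Pow N"
    have "parents t i \<subseteq> {..t}" if "i \<le> Suc t" for i
      using that by (auto simp: parents_def)
    then have "snd ` B \<subseteq> {..t}"
      using B Suc.prems(2) by (fastforce simp: N_def)
    moreover have "finite (snd ` B)"
      using B fin by (auto intro: finite_subset)
    ultimately have "all_gap t (snd ` B) \<le> (1 - p) ^ t * of_bool (snd ` B \<noteq> {})"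
      by (intro Suc.IH)
    also have "\<dots> \<le> (1 - p) ^ t * of_bool (A \<noteq> {})"
      using p B by (intro mult_left_mono) (auto simp: N_def)
    finally show "all_gap t (snd ` B) \<le> (1 - p) ^ t * of_bool (A \<noteq> {})" .
    show "0 \<le> \<kappa> B" using p by (simp add: \<kappa>_def)
  qed
  \<comment> \<open>The weights \<open>\<kappa>\<close> sum to \<open>(1 - p) ^ card N\<close>. A
    nonempty \<open>A\<close> has at least one incoming edge, which yields the extra factor
    \<open>1 - p\<close>.\<close>
  also have "\<dots> = (1 - p) ^ card N * ((1 - p) ^ t * of_bool (A \<noteq> {}))"
  proof -
    have "(1 - p) ^ card N = (\<Prod>e\<in>N. (1 - 2 * p) + p)" by simp
    also have "\<dots> = (\<Sum>B\<in>Pow N. (\<Prod>e\<in>B. 1 - 2 * p) * (\<Prod>e\<in>N - B. p))"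
      by (rule prod_add[OF fin])
    finally show ?thesis by (simp add: \<kappa>_def sum_distrib_right)
  qed
  also have "\<dots> \<le> (1 - p) ^ Suc t * of_bool (A \<noteq> {})"
  proof (cases "A = {}")
    case False
    moreover have "parents t i \<noteq> {}" for i by (simp add: parents_def)
    ultimately have "N \<noteq> {}" by (auto simp: N_def Sigma_empty_iff)
    then have "(1 - p) ^ card N \<le> (1 - p) ^ 1"
      using fin p by (intro power_decreasing) (auto simp: Suc_le_eq card_gt_0_iff)
    then show ?thesis using p by (auto intro!: mult_right_mono)
  qed simp
  finally show ?case .
qed

lemma undet_le_if_dominant:
  assumes "i \<le> t"
  shows "undet f p t i \<le> (1 - p) ^ t"
proof -
  have "of_bool (v = None) = (of_bool (v \<noteq> Some c) - of_bool (v = Some (\<not> c)) :: real)" for v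
    by (cases v; cases c) auto
  then have "undet f p t i = all_gap t {i}"
    by (simp add: undet_eq_expectation all_gap_def)
  with all_gap_le[of "{i}" t] assms show ?thesis by simp
qed

lemma tv_tendsto_0_if_dominant: "(\<lambda>t. tv_dist (eta_law f p b t) (eta_law f p b' t)) \<longlonglongrightarrow> 0"
proof (rule tv_tendsto_0I)
  have "(\<lambda>t. real t * (1 - p) ^ t + (1 - p) ^ t) \<longlonglongrightarrow> 0 + 0"
    using p by (intro tendsto_add powser_times_n_limit_0 LIMSEQ_power_zero) auto
  then have lim: "(\<lambda>t. real t * (1 - p) ^ t + (1 - p) ^ t) \<longlonglongrightarrow> 0" by simp
  have le: "(\<Sum>i\<le>t. undet f p t i) \<le> real t * (1 - p) ^ t + (1 - p) ^ t" for t
  proof -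
    have "(\<Sum>i\<le>t. undet f p t i) \<le> (\<Sum>i\<le>t. (1 - p) ^ t)"
      by (intro sum_mono undet_le_if_dominant) auto
    then show ?thesis by (simp add: algebra_simps)
  qed
  show "(\<lambda>t. \<Sum>i\<le>t. undet f p t i) \<longlonglongrightarrow> 0"
    by (rule tendsto_sandwich[OF _ _ tendsto_const lim])
       (auto intro!: always_eventually sum_nonneg undet_nonneg le)
qed (use p in auto)

end

section \<open>All gates\<close>

text \<open>The double negations are deliberate: they are the literal forms in which
  \<open>potential_complement\<close> and \<open>potential_swap\<close> return the gates. Constant
  gates are covered by \<open>first\<close>.\<close>

lemma gate_cases:
  fixes f :: "bool \<Rightarrow> bool \<Rightarrow> bool"
  obtains (first) h where "f = (\<lambda>x y. h x)"
  | (second) h where "f = (\<lambda>x y. h y)"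
  | (xor) "\<And>x y. f (\<not> x) y = (\<not> f x y)" "\<And>x y. f x (\<not> y) = (\<not> f x y)"
  | (dominant) c where "\<And>x y. f x y = c \<longleftrightarrow> x = c \<or> y = c"
  | (nand) "f = (\<lambda>x y. x \<longrightarrow> \<not> y)"
  | (nor) "f = (\<lambda>x y. \<not> (\<not> x \<longrightarrow> \<not> \<not> y))"
  | (and_not) "f = (\<lambda>x y. x \<and> \<not> y)"
  | (not_and) "f = (\<lambda>x y. y \<and> \<not> x)"
  | (or_not) "f = (\<lambda>x y. \<not> (\<not> x \<and> \<not> \<not> y))"
  | (not_or) "f = (\<lambda>x y. \<not> (\<not> y \<and> \<not> \<not> x))"
proof -
  have "(\<forall>x. f x True = f x False) \<or> (\<forall>y. f True y = f False y)
    \<or> (\<forall>x y. f (\<not> x) y = (\<not> f x y)) \<and> (\<forall>x y. f x (\<not> y) = (\<not> f x y))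
    \<or> (\<exists>c. \<forall>x y. f x y = c \<longleftrightarrow> x = c \<or> y = c)
    \<or> f = (\<lambda>x y. x \<longrightarrow> \<not> y) \<or> f = (\<lambda>x y. \<not> (\<not> x \<longrightarrow> \<not> \<not> y))
    \<or> f = (\<lambda>x y. x \<and> \<not> y) \<or> f = (\<lambda>x y. y \<and> \<not> x)
    \<or> f = (\<lambda>x y. \<not> (\<not> x \<and> \<not> \<not> y)) \<or> f = (\<lambda>x y. \<not> (\<not> y \<and> \<not> \<not> x))"
    unfolding fun_eq_iff all_bool_eq ex_bool_eq
    by (cases "f True True"; cases "f True False"; cases "f False True"; cases "f False False") simp_all
  then show thesis
  proof (elim disjE exE conjE)
    assume "\<forall>x. f x True = f x False"
    then have "f = (\<lambda>x y. f x True)" by (auto simp: fun_eq_iff all_bool_eq)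
    then show thesis by (rule first)
  next
    assume "\<forall>y. f True y = f False y"
    then have "f = (\<lambda>x y. f True y)" by (auto simp: fun_eq_iff all_bool_eq)
    then show thesis by (rule second)
  next
    assume a: "\<forall>x y. f (\<not> x) y = (\<not> f x y)" "\<forall>x y. f x (\<not> y) = (\<not> f x y)"
    show thesis by (rule xor[OF a(1)[rule_format] a(2)[rule_format]])
  next
    fix c assume a: "\<forall>x y. f x y = c \<longleftrightarrow> x = c \<or> y = c"
    show thesis by (rule dominant[OF a[rule_format]])
  qed (rule nand nor and_not not_and or_not not_or, assumption)+
qed

theorem theorem11:
  fixes f :: "bool \<Rightarrow> bool \<Rightarrow> bool"
  shows "\<exists>\<epsilon>::real>0. \<forall>p\<in>{0<..<\<epsilon>}.
    (\<lambda>t. tv_dist (eta_law f p True t) (eta_law f p False t)) \<longlonglongrightarrow> 0"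
proof (intro exI conjI ballI)
  fix p :: real
  \<comment> \<open>\<open>1/16\<close> is the range in which \<open>potential_nand\<close> and
    \<open>potential_and_not\<close> are established.\<close>
  assume "p \<in> {0<..<1/16}"
  then have p: "0 < p" "0 \<le> p" "p \<le> 1/16" "p \<le> 1/2" by auto
  then have sq: "0 < p\<^sup>2" "p\<^sup>2 \<le> 1" by (auto simp: power_le_one)
  have \<rho>: "0 \<le> 1 - 2 * p" "1 - 2 * p < 1" "0 \<le> 1 - p / 4" "1 - p / 4 < 1"
    "0 \<le> 1 - p\<^sup>2 / 4" "1 - p\<^sup>2 / 4 < 1"
    using p sq by auto
  note nand = potential_nand[OF p(2,3)] and and_not = potential_and_not[OF p(2,3)]
  note complement = potential_complement[OF p(2,4)]
  note tendsto = tv_tendsto_0_if_potential[OF p(1,4)]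
  show "(\<lambda>t. tv_dist (eta_law f p True t) (eta_law f p False t)) \<longlonglongrightarrow> 0"
  proof (cases f rule: gate_cases)
    case (first h)
    show ?thesis unfolding first by (rule tendsto[OF \<rho>(1,2) potential_first_argument[OF p(2,4)]])
  next
    case (second h)
    show ?thesis
      unfolding second by (rule tendsto[OF \<rho>(1,2) potential_swap[OF potential_first_argument[OF p(2,4)]]])
  next
    case xor
    then show ?thesis by (rule tv_tendsto_0_if_antisymmetric[OF _ _ p(1,4)])
  next
    case (dominant c)
    then show ?thesis by (rule tv_tendsto_0_if_dominant[OF _ p(1,4)])
  next
    case nand
    show ?thesis unfolding nand by (rule tendsto[OF \<rho>(5,6) potential_nand[OF p(2,3)]])
  next
    case nor
    show ?thesis unfolding nor by (rule tendsto[OF \<rho>(5,6) complement[OF nand]])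
  next
    case and_not
    show ?thesis unfolding and_not by (rule tendsto[OF \<rho>(3,4) potential_and_not[OF p(2,3)]])
  next
    case not_and
    show ?thesis unfolding not_and by (rule tendsto[OF \<rho>(3,4) potential_swap[OF and_not]])
  next
    case or_not
    show ?thesis unfolding or_not by (rule tendsto[OF \<rho>(3,4) complement[OF and_not]])
  next
    case not_or
    show ?thesis
      unfolding not_or by (rule tendsto[OF \<rho>(3,4) potential_swap[OF complement[OF and_not]]])
  qed
qed simp

end
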